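(* Let $\Omega\subset X$ be open. For given $u$ and $v\in\mathcal A(\Omega)$, let $D_i$ ($i=1,2,3$) be the following disjoint sets: $$D_1=\mathcal S^{\mathcal F}_{\mathcal A}(u)\setminus\big(\mathcal S^{\mathcal F}_{\mathcal A}(u)\cap\mathcal S^{\mathcal F}_{\mathcal A}(v)\big),\quad D_2=\mathcal S^{\mathcal F}_{\mathcal A}(v)\setminus\big(\mathcal S^{\mathcal F}_{\mathcal A}(u)\cap\mathcal S^{\mathcal F}_{\mathcal A}(v)\big),\quad D_3=\mathcal S^{\mathcal F}_{\mathcal A}(u)\cap\mathcal S^{\mathcal F}_{\mathcal A}(v).$$ Then the $(a,\mathcal F)$-singular asymptotic spectrum of $uv$ satisfies $$\mathcal S^{(a,\mathcal F)}_{\mathcal A}(uv)\subset\{(x,r): x\in D_1,\ r\in\Sigma_x(u)\}\cup\{(x,r): x\in D_2,\ r\in\Sigma_x(v)\}\cup\{(x,r): x\in D_3,\ r\in E_x(u,v)\},$$ where, for any $x\in D_3$, $$E_x(u,v)=\begin{cases}[0,\ \sup\Sigma_x(u)+\sup\Sigma_x(v)] & \text{if }\Sigma_x(u)\neq\mathbb R_+\text{ and }\Sigma_x(v)\neq\mathbb R_+,\\ \mathbb R_+ & \text{if }\Sigma_x(u)=\mathbb R_+\text{ or }\Sigma_x(v)=\mathbb R_+.\end{cases}$$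
   Context: $\mathbb K=\mathbb R$ or $\mathbb C$, $\mathbb R_+=[0,\infty)$. The algebra. $\Lambda$ is an index set; $A$ is a solid subring of $\mathbb K^\Lambda$ (if $(s_\lambda)\in\mathbb K^\Lambda$, $(r_\lambda)\in A$ and $|s_\lambda|\le|r_\lambda|$ for all $\lambda$, then $(s_\lambda)\in A$); $I_A$ is a solid ideal of $A$ (same property with $I_A$ in place of $A$). $\mathcal E$ is a sheaf of topological $\mathbb K$-algebras over a topological space $X$. For each open $\Omega\subset X$ the algebra $\mathcal E(\Omega)$ is endowed with a family of seminorms $\mathcal P(\Omega)=(p_i)_{i\in I(\Omega)}$ such that: if $\Omega_1\subset\Omega_2$ are open then $I(\Omega_1)\subset I(\Omega_2)$ and, for each $p_i\in\mathcal P(\Omega_1)$, the seminorm $u\mapsto p_i(u|_{\Omega_1})$ extends $p_i$ to $\mathcal P(\Omega_2)$; and if $\Omega=\bigcup_{h\in H}\Omega_h$ with $\Omega_h$ open, then for each $p_i\in\mathcal P(\Omega)$ there are finitely many of the $\Omega_h$, say $\Omega_1,\dots,\Omega_{n}$, and seminorms $p_k\in\mathcal P(\Omega_k)$ with $p_i(u)\le\sum_{k=1}^n p_k(u|_{\Omega_k})$ for all $u\in\mathcal E(\Omega)$. With $|B|=\{(|r_\lambda|)_\lambda:(r_\lambda)_\lambda\in B\}$, set $\mathcal H(\Omega)=\{(u_\lambda)\in\mathcal E(\Omega)^\Lambda:\forall i\in I(\Omega),\ (p_i(u_\lambda))_\lambda\in|A|\}$, $\mathcal J(\Omega)=\{(u_\lambda)\in\mathcal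 E(\Omega)^\Lambda:\forall i\in I(\Omega),\ (p_i(u_\lambda))_\lambda\in|I_A|\}$ and $\mathcal A(\Omega)=\mathcal H(\Omega)/\mathcal J(\Omega)$, a presheaf of algebras; $[u_\lambda]$ is the class of $(u_\lambda)_\lambda$; restrictions and products are defined on representatives. Asymptotics. $A$ is unitary; $\Lambda$ is directed by a partial order $\prec$, and $\lim_\Lambda x_\lambda=x$ means: for each neighborhood $W$ of $x$ there is $\lambda_0\in\Lambda$ with $x_\lambda\in W$ for all $\lambda\prec\lambda_0$. $\mathcal F$ is a sheaf or presheaf of topological $\mathbb K$-vector spaces (or topological $\mathbb K$-algebras) over $X$, whose spaces $\mathcal F(V)$ are separated and locally convex, and which contains $\mathcal E$ as a subsheaf of topological algebras. It is assumed that for every open $V$ and every $(v_\lambda)\in\mathcal J(V)$, $\lim_\Lambda v_\lambda=0$ in $\mathcal F(V)$. $a:\mathbb R_+\to A_+=\{(b_\lambda)\in A: b_\lambda\ge0\ \forall\lambda\}$, $a(r)=(a_\lambda(r))_\lambda$, satisfies $a(0)=1$, $a_\lambda(r+s)\le a_\lambda(r)a_\lambda(s)$ for all $r,s\in\mathbb R_+$ and all $\lambda$, and $\lim_\Lambda a_\lambda(r)=0$ for all $r>0$. Definitions. For $u=[u_\lambda]\in\mathcal A(\Omega)$ and $x\in\Omega$, let $\mathcal V_x$ be the set of open neighborhoods of $x$ (contained in $\Omega$). $\mathcal S^{\mathcal F}_{\mathcal A}(u)$ (the $\mathcal F$-singular support) is the set of $x\in\Omega$ for which there is no $V\in\mathcal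 V_x$ such that $\lim_\Lambda u_\lambda|_V$ exists in $\mathcal F(V)$. $N_x(u)=\{r\in\mathbb R_+:\exists V\in\mathcal V_x,\ \exists f\in\mathcal F(V):\ \lim_\Lambda a_\lambda(r)u_\lambda|_V=f\text{ in }\mathcal F(V)\}$, $\Sigma_x(u)=\mathbb R_+\setminus N_x(u)$, and the $(a,\mathcal F)$-singular (asymptotic) spectrum is $\mathcal S^{(a,\mathcal F)}_{\mathcal A}(u)=\{(x,r)\in\Omega\times\mathbb R_+: r\in\Sigma_x(u)\}$. All these are independent of the representative.
   Formalization: F is taken to be a presheaf of topological algebras with jointly continuous product; for F only of topological vector spaces (e.g. D', with u=v=[ε^{-k} sin(x/ε)]) the claim fails. The topology of E(Ω) is read as the one defined by P(Ω). *)

theory Defs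
  imports "HOL-Analysis.Analysis" "HOL-Algebra.Module"
begin

(* The scalar field \<open>'k :: real_normed_field\<close> stands for the real or complex numbers: by the
   Gelfand-Mazur theorem these are, up to isometric isomorphism, the only real normed fields whose
   norm is multiplicative. *)

definition scalar_ring :: "'k::real_normed_field ring" where
  "scalar_ring = \<lparr>carrier = UNIV, mult = (*), one = 1, zero = 0, add = (+)\<rparr>"


subsection \<open>Presheaves and sheaves of topological algebras\<close>

record ('k, 'e) top_alg = "('k, 'e) module" +
  tops :: "'e topology"

(* Algebras are associative; neither a unit nor commutativity is required, so the field
   \<open>one\<close> of the record is never used. *)

definition topological_algebra :: "('k::real_normed_field, 'e) top_alg \<Rightarrow> bool" where
  "topological_algebra M \<longleftrightarrow>
     module scalar_ring M \<and>
     (\<forall>x\<in>carrier M. \<forall>y\<in>carrier M. x \<otimes>\<^bsub>M\<^esub> y \<in> carrier M) \<and>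
     (\<forall>x\<in>carrier M. \<forall>y\<in>carrier M. \<forall>z\<in>carrier M.
        (x \<otimes>\<^bsub>M\<^esub> y) \<otimes>\<^bsub>M\<^esub> z = x \<otimes>\<^bsub>M\<^esub> (y \<otimes>\<^bsub>M\<^esub> z) \<and>
        (x \<oplus>\<^bsub>M\<^esub> y) \<otimes>\<^bsub>M\<^esub> z = x \<otimes>\<^bsub>M\<^esub> z \<oplus>\<^bsub>M\<^esub> y \<otimes>\<^bsub>M\<^esub> z \<and>
        x \<otimes>\<^bsub>M\<^esub> (y \<oplus>\<^bsub>M\<^esub> z) = x \<otimes>\<^bsub>M\<^esub> y \<oplus>\<^bsub>M\<^esub> x \<otimes>\<^bsub>M\<^esub> z) \<and>
     (\<forall>c. \<forall>x\<in>carrier M. \<forall>y\<in>carrier M.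
        (c \<odot>\<^bsub>M\<^esub> x) \<otimes>\<^bsub>M\<^esub> y = c \<odot>\<^bsub>M\<^esub> (x \<otimes>\<^bsub>M\<^esub> y) \<and>
        x \<otimes>\<^bsub>M\<^esub> (c \<odot>\<^bsub>M\<^esub> y) = c \<odot>\<^bsub>M\<^esub> (x \<otimes>\<^bsub>M\<^esub> y)) \<and>
     topspace (tops M) = carrier M \<and>
     continuous_map (prod_topology (tops M) (tops M)) (tops M) (\<lambda>(x, y). x \<oplus>\<^bsub>M\<^esub> y) \<and>
     continuous_map (prod_topology euclidean (tops M)) (tops M) (\<lambda>(c, x). c \<odot>\<^bsub>M\<^esub> x) \<and>
     continuous_map (prod_topology (tops M) (tops M)) (tops M) (\<lambda>(x, y). x \<otimes>\<^bsub>M\<^esub> y)"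

definition convex_subset :: "('k::real_normed_field, 'e) top_alg \<Rightarrow> 'e set \<Rightarrow> bool" where
  "convex_subset M C \<longleftrightarrow> C \<subseteq> carrier M \<and>
     (\<forall>x\<in>C. \<forall>y\<in>C. \<forall>t::real. 0 \<le> t \<and> t \<le> 1 \<longrightarrow>
        of_real t \<odot>\<^bsub>M\<^esub> x \<oplus>\<^bsub>M\<^esub> of_real (1 - t) \<odot>\<^bsub>M\<^esub> y \<in> C)"

definition locally_convex_alg :: "('k::real_normed_field, 'e) top_alg \<Rightarrow> bool" where
  "locally_convex_alg M \<longleftrightarrow> neighbourhood_base_at \<zero>\<^bsub>M\<^esub> (convex_subset M) (tops M)"

definition top_alg_hom ::
    "('k::real_normed_field, 'e) top_alg \<Rightarrow> ('k, 'f) top_alg \<Rightarrow> ('e \<Rightarrow> 'f) \<Rightarrow> bool" where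
  "top_alg_hom M N h \<longleftrightarrow>
     h \<in> carrier M \<rightarrow> carrier N \<and>
     (\<forall>x\<in>carrier M. \<forall>y\<in>carrier M. h (x \<oplus>\<^bsub>M\<^esub> y) = h x \<oplus>\<^bsub>N\<^esub> h y) \<and>
     (\<forall>x\<in>carrier M. \<forall>y\<in>carrier M. h (x \<otimes>\<^bsub>M\<^esub> y) = h x \<otimes>\<^bsub>N\<^esub> h y) \<and>
     (\<forall>c. \<forall>x\<in>carrier M. h (c \<odot>\<^bsub>M\<^esub> x) = c \<odot>\<^bsub>N\<^esub> h x) \<and>
     continuous_map (tops M) (tops N) h"

(* \<open>res F V W\<close> is the restriction from \<open>V\<close> to the smaller open set \<open>W\<close>. *)

record ('x, 'k, 'e) presheaf =
  sec :: "'x set \<Rightarrow> ('k, 'e) top_alg"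
  res :: "'x set \<Rightarrow> 'x set \<Rightarrow> 'e \<Rightarrow> 'e"

definition alg_presheaf :: "'x topology \<Rightarrow> ('x, 'k::real_normed_field, 'e) presheaf \<Rightarrow> bool" where
  "alg_presheaf X F \<longleftrightarrow>
     (\<forall>V. openin X V \<longrightarrow> topological_algebra (sec F V)) \<and>
     (\<forall>V W. openin X V \<and> openin X W \<and> W \<subseteq> V \<longrightarrow> top_alg_hom (sec F V) (sec F W) (res F V W)) \<and>
     (\<forall>V. openin X V \<longrightarrow> (\<forall>u\<in>carrier (sec F V). res F V V u = u)) \<and>
     (\<forall>U V W. openin X U \<and> openin X V \<and> openin X W \<and> W \<subseteq> V \<and> V \<subseteq> U \<longrightarrow>
        (\<forall>u\<in>carrier (sec F U). res F V W (res F U V u) = res F U W u))"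

definition alg_sheaf :: "'x topology \<Rightarrow> ('x, 'k::real_normed_field, 'e) presheaf \<Rightarrow> bool" where
  "alg_sheaf X E \<longleftrightarrow> alg_presheaf X E \<and>
     (\<forall>\<U>. (\<forall>U\<in>\<U>. openin X U) \<longrightarrow>
        (\<forall>u\<in>carrier (sec E (\<Union>\<U>)). \<forall>v\<in>carrier (sec E (\<Union>\<U>)).
           (\<forall>U\<in>\<U>. res E (\<Union>\<U>) U u = res E (\<Union>\<U>) U v) \<longrightarrow> u = v) \<and>
        (\<forall>s. (\<forall>U\<in>\<U>. s U \<in> carrier (sec E U)) \<and>
             (\<forall>U\<in>\<U>. \<forall>V\<in>\<U>. res E U (U \<inter> V) (s U) = res E V (U \<inter> V) (s V)) \<longrightarrow>
           (\<exists>u\<in>carrier (sec E (\<Union>\<U>)). \<forall>U\<in>\<U>. res E (\<Union>\<U>) U u = s U)))"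


subsection \<open>Seminorms\<close>

definition seminorm_on :: "('k::real_normed_field, 'e) top_alg \<Rightarrow> ('e \<Rightarrow> real) \<Rightarrow> bool" where
  "seminorm_on M p \<longleftrightarrow>
     (\<forall>x\<in>carrier M. 0 \<le> p x) \<and>
     (\<forall>x\<in>carrier M. \<forall>y\<in>carrier M. p (x \<oplus>\<^bsub>M\<^esub> y) \<le> p x + p y) \<and>
     (\<forall>c. \<forall>x\<in>carrier M. p (c \<odot>\<^bsub>M\<^esub> x) = norm c * p x)"

definition topology_from_seminorms ::
    "('k::real_normed_field, 'e) top_alg \<Rightarrow> 'i set \<Rightarrow> ('i \<Rightarrow> 'e \<Rightarrow> real) \<Rightarrow> bool" where
  "topology_from_seminorms M I p \<longleftrightarrow>
     (\<forall>U. openin (tops M) U \<longleftrightarrow> U \<subseteq> carrier M \<and>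
        (\<forall>x\<in>U. \<exists>J \<epsilon>. finite J \<and> J \<subseteq> I \<and> 0 < \<epsilon> \<and>
           {y \<in> carrier M. \<forall>j\<in>J. p j (y \<ominus>\<^bsub>M\<^esub> x) < \<epsilon>} \<subseteq> U))"

definition seminorm_system ::
    "'x topology \<Rightarrow> ('x, 'k::real_normed_field, 'e) presheaf \<Rightarrow> ('x set \<Rightarrow> 'i set) \<Rightarrow>
     ('x set \<Rightarrow> 'i \<Rightarrow> 'e \<Rightarrow> real) \<Rightarrow> bool" where
  "seminorm_system X E I p \<longleftrightarrow>
     (\<forall>V. openin X V \<longrightarrow> (\<forall>i\<in>I V. seminorm_on (sec E V) (p V i)) \<and>
        topology_from_seminorms (sec E V) (I V) (p V)) \<and>
     (\<forall>V W. openin X V \<and> openin X W \<and> W \<subseteq> V \<longrightarrow> I W \<subseteq> I V \<and>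
        (\<forall>i\<in>I W. \<forall>u\<in>carrier (sec E V). p V i u = p W i (res E V W u))) \<and>
     (\<forall>\<U>. (\<forall>U\<in>\<U>. openin X U) \<longrightarrow>
        (\<forall>i\<in>I (\<Union>\<U>). \<exists>(n::nat) W k. (\<forall>j<n. W j \<in> \<U> \<and> k j \<in> I (W j)) \<and>
           (\<forall>u\<in>carrier (sec E (\<Union>\<U>)).
              p (\<Union>\<U>) i u \<le> (\<Sum>j<n. p (W j) (k j) (res E (\<Union>\<U>) (W j) u)))))"


subsection \<open>The ring of scalar nets and its ideal\<close>

definition solid :: "('l \<Rightarrow> 'k::real_normed_field) set \<Rightarrow> bool" where
  "solid B \<longleftrightarrow> (\<forall>s r. r \<in> B \<and> (\<forall>l. norm (s l) \<le> norm (r l)) \<longrightarrow> s \<in> B)"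

definition unital_subring :: "('l \<Rightarrow> 'k::real_normed_field) set \<Rightarrow> bool" where
  "unital_subring A \<longleftrightarrow> (\<lambda>l. 1) \<in> A \<and>
     (\<forall>r\<in>A. \<forall>s\<in>A. (\<lambda>l. r l - s l) \<in> A \<and> (\<lambda>l. r l * s l) \<in> A)"

definition net_ideal :: "('l \<Rightarrow> 'k::real_normed_field) set \<Rightarrow> ('l \<Rightarrow> 'k) set \<Rightarrow> bool" where
  "net_ideal J A \<longleftrightarrow> J \<subseteq> A \<and> J \<noteq> {} \<and>
     (\<forall>r\<in>J. \<forall>s\<in>J. (\<lambda>l. r l - s l) \<in> J) \<and>
     (\<forall>r\<in>A. \<forall>s\<in>J. (\<lambda>l. r l * s l) \<in> J)"

definition abs_nets :: "('l \<Rightarrow> 'k::real_normed_field) set \<Rightarrow> ('l \<Rightarrow> real) set" where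
  "abs_nets B = (\<lambda>r l. norm (r l)) ` B"


subsection \<open>The setting\<close>

(* The index set is the type \<open>'l\<close>, ordered by its \<open>order\<close> class instance. The limit of a net takes
   small indices, so it is the limit along \<open>at_bot\<close>; see \<open>eventually_at_bot_directed\<close> below.
   \<open>emb V\<close> is the inclusion of the sections of \<open>shE\<close> over \<open>V\<close> into those of \<open>shF\<close>. *)

record ('x, 'l, 'k, 'e, 'f, 'i) setting =
  base :: "'x topology"
  nets :: "('l \<Rightarrow> 'k) set"
  null_nets :: "('l \<Rightarrow> 'k) set"
  shE :: "('x, 'k, 'e) presheaf"
  idx :: "'x set \<Rightarrow> 'i set"
  semi :: "'x set \<Rightarrow> 'i \<Rightarrow> 'e \<Rightarrow> real"
  shF :: "('x, 'k, 'f) presheaf"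
  emb :: "'x set \<Rightarrow> 'e \<Rightarrow> 'f"
  scl :: "real \<Rightarrow> 'l \<Rightarrow> real"

lemma eventually_at_bot_directed:
  assumes "\<forall>l m :: 'l::order. \<exists>n. n \<le> l \<and> n \<le> m"
  shows "eventually P (at_bot :: 'l filter) \<longleftrightarrow> (\<exists>l0. \<forall>l\<le>l0. P l)"
proof -
  have "eventually P (at_bot :: 'l filter) \<longleftrightarrow> (\<exists>b\<in>UNIV. eventually P (principal {..b}))"
    unfolding at_bot_def
  proof (rule eventually_INF_base)
    fix a b :: 'l
    obtain n where "n \<le> a" "n \<le> b" using assms by blast
    then show "\<exists>x\<in>UNIV. principal {..x} \<le> inf (principal {..a}) (principal {..b})"
      by (auto intro!: exI[of _ n])
  qed simp
  then show ?thesis by (auto simp: eventually_principal)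
qed

definition moderate_nets ::
    "('x, 'l, 'k::real_normed_field, 'e, 'f, 'i) setting \<Rightarrow> 'x set \<Rightarrow> ('l \<Rightarrow> 'e) set" where
  "moderate_nets S \<Omega> = {u. (\<forall>l. u l \<in> carrier (sec (shE S) \<Omega>)) \<and>
     (\<forall>i\<in>idx S \<Omega>. (\<lambda>l. semi S \<Omega> i (u l)) \<in> abs_nets (nets S))}"

definition negligible_nets ::
    "('x, 'l, 'k::real_normed_field, 'e, 'f, 'i) setting \<Rightarrow> 'x set \<Rightarrow> ('l \<Rightarrow> 'e) set" where
  "negligible_nets S \<Omega> = {u. (\<forall>l. u l \<in> carrier (sec (shE S) \<Omega>)) \<and>
     (\<forall>i\<in>idx S \<Omega>. (\<lambda>l. semi S \<Omega> i (u l)) \<in> abs_nets (null_nets S))}"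

definition net_limit ::
    "('x, 'l::order, 'k::real_normed_field, 'e, 'f, 'i) setting \<Rightarrow> 'x set \<Rightarrow> ('l \<Rightarrow> 'e) \<Rightarrow> 'f \<Rightarrow> bool"
  where
  "net_limit S V w f \<longleftrightarrow> limitin (tops (sec (shF S) V)) (\<lambda>l. emb S V (w l)) f at_bot"

definition asymptotic_setting ::
    "('x, 'l::order, 'k::real_normed_field, 'e, 'f, 'i) setting \<Rightarrow> bool" where
  "asymptotic_setting S \<longleftrightarrow>
     (\<forall>l m :: 'l. \<exists>n. n \<le> l \<and> n \<le> m) \<and>
     unital_subring (nets S) \<and> solid (nets S) \<and>
     net_ideal (null_nets S) (nets S) \<and> solid (null_nets S) \<and>
     alg_sheaf (base S) (shE S) \<and>
     seminorm_system (base S) (shE S) (idx S) (semi S) \<and>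
     alg_presheaf (base S) (shF S) \<and>
     (\<forall>V. openin (base S) V \<longrightarrow>
        Hausdorff_space (tops (sec (shF S) V)) \<and> locally_convex_alg (sec (shF S) V)) \<and>
     (\<forall>V. openin (base S) V \<longrightarrow>
        top_alg_hom (sec (shE S) V) (sec (shF S) V) (emb S V) \<and>
        inj_on (emb S V) (carrier (sec (shE S) V))) \<and>
     (\<forall>V W. openin (base S) V \<and> openin (base S) W \<and> W \<subseteq> V \<longrightarrow>
        (\<forall>u\<in>carrier (sec (shE S) V).
           emb S W (res (shE S) V W u) = res (shF S) V W (emb S V u))) \<and>
     (\<forall>V. openin (base S) V \<longrightarrow>
        (\<forall>v\<in>negligible_nets S V. net_limit S V v \<zero>\<^bsub>sec (shF S) V\<^esub>)) \<and>
     (\<forall>r\<ge>0. (\<lambda>l. of_real (scl S r l)) \<in> nets S \<and> (\<forall>l. 0 \<le> scl S r l)) \<and>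
     (\<forall>l. scl S 0 l = 1) \<and>
     (\<forall>r\<ge>0. \<forall>s\<ge>0. \<forall>l. scl S (r + s) l \<le> scl S r l * scl S s l) \<and>
     (\<forall>r>0. (scl S r \<longlongrightarrow> 0) at_bot)"


subsection \<open>The generalized function algebra\<close>

definition gen_rel ::
    "('x, 'l, 'k::real_normed_field, 'e, 'f, 'i) setting \<Rightarrow> 'x set \<Rightarrow> (('l \<Rightarrow> 'e) \<times> ('l \<Rightarrow> 'e)) set" where
  "gen_rel S \<Omega> = {(u, v). u \<in> moderate_nets S \<Omega> \<and> v \<in> moderate_nets S \<Omega> \<and>
     (\<lambda>l. u l \<ominus>\<^bsub>sec (shE S) \<Omega>\<^esub> v l) \<in> negligible_nets S \<Omega>}"

definition gen_alg ::
    "('x, 'l, 'k::real_normed_field, 'e, 'f, 'i) setting \<Rightarrow> 'x set \<Rightarrow> ('l \<Rightarrow> 'e) set set" where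
  "gen_alg S \<Omega> = moderate_nets S \<Omega> // gen_rel S \<Omega>"

definition gen_mult ::
    "('x, 'l, 'k::real_normed_field, 'e, 'f, 'i) setting \<Rightarrow> 'x set \<Rightarrow>
     ('l \<Rightarrow> 'e) set \<Rightarrow> ('l \<Rightarrow> 'e) set \<Rightarrow> ('l \<Rightarrow> 'e) set" where
  "gen_mult S \<Omega> U V =
     (\<Union>u\<in>U. \<Union>v\<in>V. gen_rel S \<Omega> `` {\<lambda>l. u l \<otimes>\<^bsub>sec (shE S) \<Omega>\<^esub> v l})"


subsection \<open>Singular support and singular spectrum\<close>

definition open_nbhds ::
    "('x, 'l, 'k::real_normed_field, 'e, 'f, 'i) setting \<Rightarrow> 'x set \<Rightarrow> 'x \<Rightarrow> 'x set set" where
  "open_nbhds S \<Omega> x = {V. openin (base S) V \<and> x \<in> V \<and> V \<subseteq> \<Omega>}"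

(* The properties below do not depend on the representative \<open>u\<close> of the class \<open>U\<close>
   (\<open>F_sing_supp_class\<close> and \<open>conv_exps_class\<close>), so asking for some representative is the same as
   asking for all of them. *)

definition F_sing_supp ::
    "('x, 'l::order, 'k::real_normed_field, 'e, 'f, 'i) setting \<Rightarrow> 'x set \<Rightarrow> ('l \<Rightarrow> 'e) set \<Rightarrow> 'x set"
  where
  "F_sing_supp S \<Omega> U = {x\<in>\<Omega>. \<not> (\<exists>u\<in>U. \<exists>V\<in>open_nbhds S \<Omega> x. \<exists>f.
     net_limit S V (\<lambda>l. res (shE S) \<Omega> V (u l)) f)}"

definition conv_exps ::
    "('x, 'l::order, 'k::real_normed_field, 'e, 'f, 'i) setting \<Rightarrow> 'x set \<Rightarrow> ('l \<Rightarrow> 'e) set \<Rightarrow>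
     'x \<Rightarrow> real set" where
  "conv_exps S \<Omega> U x = {r. 0 \<le> r \<and> (\<exists>u\<in>U. \<exists>V\<in>open_nbhds S \<Omega> x. \<exists>f.
     net_limit S V (\<lambda>l. of_real (scl S r l) \<odot>\<^bsub>sec (shE S) V\<^esub> res (shE S) \<Omega> V (u l)) f)}"

definition sing_exps ::
    "('x, 'l::order, 'k::real_normed_field, 'e, 'f, 'i) setting \<Rightarrow> 'x set \<Rightarrow> ('l \<Rightarrow> 'e) set \<Rightarrow>
     'x \<Rightarrow> real set" where
  "sing_exps S \<Omega> U x = {0..} - conv_exps S \<Omega> U x"

definition sing_spectrum ::
    "('x, 'l::order, 'k::real_normed_field, 'e, 'f, 'i) setting \<Rightarrow> 'x set \<Rightarrow> ('l \<Rightarrow> 'e) set \<Rightarrow>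
     ('x \<times> real) set" where
  "sing_spectrum S \<Omega> U = {(x, r). x \<in> \<Omega> \<and> 0 \<le> r \<and> r \<in> sing_exps S \<Omega> U x}"

subsection \<open>Independence of representatives\<close>

lemma scalar_ring_simps [simp]:
  "carrier scalar_ring = UNIV" "\<one>\<^bsub>scalar_ring\<^esub> = 1" "\<zero>\<^bsub>scalar_ring\<^esub> = 0"
  "c \<oplus>\<^bsub>scalar_ring\<^esub> d = c + d" "c \<otimes>\<^bsub>scalar_ring\<^esub> d = c * d"
  by (simp_all add: scalar_ring_def)

lemma solidD: "solid B \<Longrightarrow> r \<in> B \<Longrightarrow> (\<And>l. norm (s l) \<le> norm (r l)) \<Longrightarrow> s \<in> B"
  unfolding solid_def by blast

lemma abs_nets_iff:
  fixes B :: "('l \<Rightarrow> 'k::real_normed_field) set"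
  assumes "solid B"
  shows "f \<in> abs_nets B \<longleftrightarrow> (\<forall>l. 0 \<le> f l) \<and> (\<lambda>l. of_real (f l)) \<in> B"
proof
  assume "f \<in> abs_nets B"
  then obtain r where r: "r \<in> B" "f = (\<lambda>l. norm (r l))" by (auto simp: abs_nets_def)
  moreover have "(\<lambda>l. of_real (norm (r l))) \<in> B"
    by (rule solidD[OF assms r(1)]) simp
  ultimately show "(\<forall>l. 0 \<le> f l) \<and> (\<lambda>l. of_real (f l)) \<in> B" by simp
next
  assume *: "(\<forall>l. 0 \<le> f l) \<and> (\<lambda>l. of_real (f l)) \<in> B"
  then have "f = (\<lambda>l. norm (of_real (f l) :: 'k))" by (auto simp: fun_eq_iff)
  with * show "f \<in> abs_nets B"
    unfolding abs_nets_def by (intro image_eqI[where x = "\<lambda>l. of_real (f l)"]) simp_all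
qed

lemma net_ideal_self:
  assumes "unital_subring A" shows "net_ideal A A"
  using assms by (auto simp: net_ideal_def unital_subring_def)

lemma net_idealD:
  assumes "net_ideal B A"
  shows "r \<in> B \<Longrightarrow> s \<in> B \<Longrightarrow> (\<lambda>l. r l - s l) \<in> B" "r \<in> A \<Longrightarrow> s \<in> B \<Longrightarrow> (\<lambda>l. r l * s l) \<in> B"
  using assms by (simp_all add: net_ideal_def)

lemma abs_nets_mono:
  assumes "solid B" "f \<in> abs_nets B" "\<And>l. 0 \<le> g l" "\<And>l. g l \<le> f l"
  shows "g \<in> abs_nets B"
proof -
  have f: "(\<lambda>l. of_real (f l)) \<in> B" using assms by (simp add: abs_nets_iff)
  have "norm (g l) \<le> norm (f l)" for l using assms(3,4)[of l] by simp
  then have "(\<lambda>l. of_real (g l)) \<in> B" by (intro solidD[OF assms(1) f]) simp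
  with assms(3) show ?thesis by (simp add: abs_nets_iff[OF assms(1)])
qed

lemma abs_nets_zero:
  assumes "net_ideal B A" "solid B" shows "(\<lambda>l. 0) \<in> abs_nets B"
proof -
  obtain r where "r \<in> B" using assms by (auto simp: net_ideal_def)
  then have "(\<lambda>l. norm (r l)) \<in> abs_nets B" by (auto simp: abs_nets_def)
  then show ?thesis by (rule abs_nets_mono[OF assms(2)]) auto
qed

lemma abs_nets_add:
  assumes "net_ideal B A" "solid B" "f \<in> abs_nets B" "g \<in> abs_nets B"
  shows "(\<lambda>l. f l + g l) \<in> abs_nets B"
proof -
  have f: "(\<lambda>l. of_real (f l)) \<in> B" "(\<lambda>l. of_real (g l)) \<in> B" "\<forall>l. 0 \<le> f l" "\<forall>l. 0 \<le> g l"
    using assms by (auto simp: abs_nets_iff)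
  have "(\<lambda>l. - of_real (g l)) \<in> B"
    by (rule solidD[OF assms(2) f(2)]) simp
  from net_idealD(1)[OF assms(1) f(1) this]
  have "(\<lambda>l. of_real (f l) - - of_real (g l)) \<in> B" .
  with f show ?thesis by (simp add: abs_nets_iff[OF assms(2)])
qed

lemma abs_nets_mult:
  assumes "net_ideal B A" "solid B" "solid A" "f \<in> abs_nets A" "g \<in> abs_nets B"
  shows "(\<lambda>l. f l * g l) \<in> abs_nets B"
proof -
  have f: "(\<lambda>l. of_real (f l)) \<in> A" "(\<lambda>l. of_real (g l)) \<in> B" "\<forall>l. 0 \<le> f l" "\<forall>l. 0 \<le> g l"
    using assms by (auto simp: abs_nets_iff)
  from net_idealD(2)[OF assms(1) f(1,2)]
  have "(\<lambda>l. of_real (f l) * of_real (g l)) \<in> B" .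
  with f show ?thesis by (simp add: abs_nets_iff[OF assms(2)])
qed

lemma abs_nets_sum:
  assumes "net_ideal B A" "solid B" "finite J" "\<And>j. j \<in> J \<Longrightarrow> f j \<in> abs_nets B"
  shows "(\<lambda>l. \<Sum>j\<in>J. f j l) \<in> abs_nets B"
  using assms(3,4)
  by (induction J rule: finite_induct)
     (auto simp: abs_nets_zero[OF assms(1,2)] intro: abs_nets_add[OF assms(1,2)])

lemma abs_nets_const:
  assumes "unital_subring A" "solid A" "0 \<le> (C::real)"
  shows "(\<lambda>l. C) \<in> abs_nets A"
proof -
  have "(\<lambda>l. 1::real) \<in> abs_nets A"
    using assms by (simp add: abs_nets_iff unital_subring_def)
  then have "(\<lambda>l. \<Sum>j<nat \<lceil>C\<rceil>. 1::real) \<in> abs_nets A"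
    by (intro abs_nets_sum[OF net_ideal_self[OF assms(1)] assms(2)]) auto
  then show ?thesis
    by (rule abs_nets_mono[OF assms(2)]) (use assms in \<open>auto simp: of_nat_ceiling\<close>)
qed

lemma topological_algebraD:
  assumes "topological_algebra M"
  shows "module scalar_ring M" "\<And>x y. x \<in> carrier M \<Longrightarrow> y \<in> carrier M \<Longrightarrow> x \<otimes>\<^bsub>M\<^esub> y \<in> carrier M"
    "\<And>x y z. x \<in> carrier M \<Longrightarrow> y \<in> carrier M \<Longrightarrow> z \<in> carrier M \<Longrightarrow>
       (x \<oplus>\<^bsub>M\<^esub> y) \<otimes>\<^bsub>M\<^esub> z = x \<otimes>\<^bsub>M\<^esub> z \<oplus>\<^bsub>M\<^esub> y \<otimes>\<^bsub>M\<^esub> z"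
    "\<And>x y z. x \<in> carrier M \<Longrightarrow> y \<in> carrier M \<Longrightarrow> z \<in> carrier M \<Longrightarrow>
       x \<otimes>\<^bsub>M\<^esub> (y \<oplus>\<^bsub>M\<^esub> z) = x \<otimes>\<^bsub>M\<^esub> y \<oplus>\<^bsub>M\<^esub> x \<otimes>\<^bsub>M\<^esub> z"
    "\<And>c x y. x \<in> carrier M \<Longrightarrow> y \<in> carrier M \<Longrightarrow> (c \<odot>\<^bsub>M\<^esub> x) \<otimes>\<^bsub>M\<^esub> y = c \<odot>\<^bsub>M\<^esub> (x \<otimes>\<^bsub>M\<^esub> y)"
    "\<And>c x y. x \<in> carrier M \<Longrightarrow> y \<in> carrier M \<Longrightarrow> x \<otimes>\<^bsub>M\<^esub> (c \<odot>\<^bsub>M\<^esub> y) = c \<odot>\<^bsub>M\<^esub> (x \<otimes>\<^bsub>M\<^esub> y)"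
    "topspace (tops M) = carrier M"
    "continuous_map (prod_topology (tops M) (tops M)) (tops M) (\<lambda>(x, y). x \<oplus>\<^bsub>M\<^esub> y)"
    "continuous_map (prod_topology (tops M) (tops M)) (tops M) (\<lambda>(x, y). x \<otimes>\<^bsub>M\<^esub> y)"
  using assms unfolding topological_algebra_def by blast+

lemma module_closed:
  assumes "topological_algebra M"
  shows "\<zero>\<^bsub>M\<^esub> \<in> carrier M"
    "\<And>x y. x \<in> carrier M \<Longrightarrow> y \<in> carrier M \<Longrightarrow> x \<oplus>\<^bsub>M\<^esub> y \<in> carrier M"
    "\<And>x y. x \<in> carrier M \<Longrightarrow> y \<in> carrier M \<Longrightarrow> x \<ominus>\<^bsub>M\<^esub> y \<in> carrier M"
    "\<And>c x. x \<in> carrier M \<Longrightarrow> c \<odot>\<^bsub>M\<^esub> x \<in> carrier M"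
    "\<And>x. x \<in> carrier M \<Longrightarrow> 0 \<odot>\<^bsub>M\<^esub> x = \<zero>\<^bsub>M\<^esub>"
    "\<And>x. x \<in> carrier M \<Longrightarrow> \<ominus>\<^bsub>M\<^esub> x = (-1) \<odot>\<^bsub>M\<^esub> x"
proof -
  interpret module scalar_ring M by (rule topological_algebraD(1)[OF assms])
  show "\<zero>\<^bsub>M\<^esub> \<in> carrier M" by simp
  show "x \<oplus>\<^bsub>M\<^esub> y \<in> carrier M" "x \<ominus>\<^bsub>M\<^esub> y \<in> carrier M"
    if "x \<in> carrier M" "y \<in> carrier M" for x y using that by (simp_all add: a_minus_def)
  show "c \<odot>\<^bsub>M\<^esub> x \<in> carrier M" if "x \<in> carrier M" for c x using smult_closed[of c x] that by simp
  show z: "0 \<odot>\<^bsub>M\<^esub> x = \<zero>\<^bsub>M\<^esub>" if "x \<in> carrier M" for x using smult_l_null[OF that] by simp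
  show "\<ominus>\<^bsub>M\<^esub> x = (-1) \<odot>\<^bsub>M\<^esub> x" if x: "x \<in> carrier M" for x
  proof -
    have c: "(-1) \<odot>\<^bsub>M\<^esub> x \<in> carrier M" using smult_closed[of "-1" x] x by simp
    have "(-1) \<odot>\<^bsub>M\<^esub> x \<oplus>\<^bsub>M\<^esub> x = ((-1) + 1) \<odot>\<^bsub>M\<^esub> x"
      using smult_l_distr[of "-1" 1 x] smult_one[OF x] x by simp
    also have "\<dots> = \<zero>\<^bsub>M\<^esub>" using z[OF x] by simp
    finally show ?thesis using M.minus_equality[OF _ x c] by simp
  qed
qed

lemma seminorm_facts:
  fixes M :: "('k::real_normed_field, 'e) top_alg"
  assumes "topological_algebra M" "seminorm_on M p"
  shows "p \<zero>\<^bsub>M\<^esub> = 0"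
    "\<And>x y. x \<in> carrier M \<Longrightarrow> y \<in> carrier M \<Longrightarrow> p (x \<ominus>\<^bsub>M\<^esub> y) \<le> p x + p y"
    "\<And>x y. x \<in> carrier M \<Longrightarrow> y \<in> carrier M \<Longrightarrow> p (y \<ominus>\<^bsub>M\<^esub> x) = p (x \<ominus>\<^bsub>M\<^esub> y)"
proof -
  note c = module_closed[OF assms(1)]
  interpret module scalar_ring M by (rule topological_algebraD(1)[OF assms(1)])
  have "p (0 \<odot>\<^bsub>M\<^esub> \<zero>\<^bsub>M\<^esub>) = norm (0::'k) * p \<zero>\<^bsub>M\<^esub>"
    using assms(2) c(1) unfolding seminorm_on_def by blast
  then show "p \<zero>\<^bsub>M\<^esub> = 0" using c by simp
  have neg: "p (\<ominus>\<^bsub>M\<^esub> x) = p x" if "x \<in> carrier M" for x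
    using assms(2) that unfolding seminorm_on_def c(6)[OF that] by simp
  show "p (x \<ominus>\<^bsub>M\<^esub> y) \<le> p x + p y" if "x \<in> carrier M" "y \<in> carrier M" for x y
  proof -
    have "p (x \<oplus>\<^bsub>M\<^esub> (\<ominus>\<^bsub>M\<^esub> y)) \<le> p x + p (\<ominus>\<^bsub>M\<^esub> y)"
      using assms(2) that(1) M.a_inv_closed[OF that(2)] unfolding seminorm_on_def by blast
    then show ?thesis using neg[OF that(2)] by (simp add: a_minus_def)
  qed
  show "p (y \<ominus>\<^bsub>M\<^esub> x) = p (x \<ominus>\<^bsub>M\<^esub> y)" if "x \<in> carrier M" "y \<in> carrier M" for x y
  proof -
    have "y \<ominus>\<^bsub>M\<^esub> x = \<ominus>\<^bsub>M\<^esub> (x \<ominus>\<^bsub>M\<^esub> y)"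
      using that by (simp add: a_minus_def M.minus_add M.a_comm)
    with neg[OF c(3)[OF that]] show ?thesis by simp
  qed
qed

lemma seminorm_mult_bound:
  fixes M :: "('k::real_normed_field, 'e) top_alg"
  assumes M: "topological_algebra M" and p: "\<forall>i\<in>I. seminorm_on M (p i)"
    and T: "topology_from_seminorms M I p" and i: "i \<in> I"
  obtains J C where "finite J" "J \<subseteq> I" "0 \<le> (C::real)"
    "\<And>x y. x \<in> carrier M \<Longrightarrow> y \<in> carrier M \<Longrightarrow>
       p i (x \<otimes>\<^bsub>M\<^esub> y) \<le> C * ((\<Sum>j\<in>J. p j x) * (\<Sum>j\<in>J. p j y))"
proof -
  note c = module_closed[OF M] and t = topological_algebraD[OF M]
  interpret module scalar_ring M by (rule t(1))
  have pn: "0 \<le> p j x" if "j \<in> I" "x \<in> carrier M" for j x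
    using p that by (auto simp: seminorm_on_def)
  have psc: "p j (k \<odot>\<^bsub>M\<^esub> x) = norm k * p j x" if "j \<in> I" "x \<in> carrier M" for j k x
    using p that by (auto simp: seminorm_on_def)
  have m0: "x \<ominus>\<^bsub>M\<^esub> \<zero>\<^bsub>M\<^esub> = x" if "x \<in> carrier M" for x
    using that by (simp add: a_minus_def)
  let ?U = "{z \<in> carrier M. p i z < 1}"
  have "openin (tops M) ?U"
    unfolding T[unfolded topology_from_seminorms_def, rule_format]
  proof (intro conjI ballI)
    fix x assume x: "x \<in> ?U"
    show "\<exists>J \<epsilon>. finite J \<and> J \<subseteq> I \<and> 0 < \<epsilon> \<and> {y \<in> carrier M. \<forall>j\<in>J. p j (y \<ominus>\<^bsub>M\<^esub> x) < \<epsilon>} \<subseteq> ?U"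
    proof (rule exI[of _ "{i}"], rule exI[of _ "1 - p i x"], intro conjI subsetI)
      fix y assume "y \<in> {y \<in> carrier M. \<forall>j\<in>{i}. p j (y \<ominus>\<^bsub>M\<^esub> x) < 1 - p i x}"
      then have y: "y \<in> carrier M" "p i (y \<ominus>\<^bsub>M\<^esub> x) < 1 - p i x" by auto
      have "y = (y \<ominus>\<^bsub>M\<^esub> x) \<oplus>\<^bsub>M\<^esub> x"
        using x y by (simp add: a_minus_def M.a_assoc M.l_neg)
      then have "p i y \<le> p i (y \<ominus>\<^bsub>M\<^esub> x) + p i x"
        using p i x y(1) c(3)[of y x] unfolding seminorm_on_def by (metis (no_types, lifting) mem_Collect_eq)
      with y show "y \<in> ?U" by simp
    qed (use x i in auto)
  qed auto
  then have op: "openin (prod_topology (tops M) (tops M))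
      {w \<in> topspace (prod_topology (tops M) (tops M)). (case w of (x, y) \<Rightarrow> x \<otimes>\<^bsub>M\<^esub> y) \<in> ?U}" (is "openin _ ?P")
    using t(9) by (rule openin_continuous_map_preimage[rotated])
  have z: "\<zero>\<^bsub>M\<^esub> \<otimes>\<^bsub>M\<^esub> \<zero>\<^bsub>M\<^esub> = \<zero>\<^bsub>M\<^esub>"
    using t(5)[OF c(1) c(1), of 0] c(5)[OF c(1)] c(5)[OF t(2)[OF c(1) c(1)]] by simp
  then have "(\<zero>\<^bsub>M\<^esub>, \<zero>\<^bsub>M\<^esub>) \<in> ?P"
    using c(1) t(7) seminorm_facts(1)[OF M, of "p i"] p i by simp
  from op[unfolded openin_prod_topology_alt, rule_format, OF this]
  obtain U1 U2 where U: "openin (tops M) U1" "openin (tops M) U2"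
      "\<zero>\<^bsub>M\<^esub> \<in> U1" "\<zero>\<^bsub>M\<^esub> \<in> U2" "U1 \<times> U2 \<subseteq> ?P"
    by (elim exE conjE)
  have nb: "\<exists>J \<epsilon>. finite J \<and> J \<subseteq> I \<and> 0 < \<epsilon> \<and> {y \<in> carrier M. \<forall>j\<in>J. p j (y \<ominus>\<^bsub>M\<^esub> x) < \<epsilon>} \<subseteq> W"
    if "openin (tops M) W" "x \<in> W" for W x
    using T that unfolding topology_from_seminorms_def by simp
  obtain J1 e1 where 1: "finite J1" "J1 \<subseteq> I" "0 < e1"
      "{y \<in> carrier M. \<forall>j\<in>J1. p j (y \<ominus>\<^bsub>M\<^esub> \<zero>\<^bsub>M\<^esub>) < e1} \<subseteq> U1"
    using nb[OF U(1) U(3)] by (elim exE conjE)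
  obtain J2 e2 where 2: "finite J2" "J2 \<subseteq> I" "0 < e2"
      "{y \<in> carrier M. \<forall>j\<in>J2. p j (y \<ominus>\<^bsub>M\<^esub> \<zero>\<^bsub>M\<^esub>) < e2} \<subseteq> U2"
    using nb[OF U(2) U(4)] by (elim exE conjE)
  define J where "J = J1 \<union> J2"
  define e where "e = min e1 e2 / 2"
  have e: "0 < e" "e < e1" "e < e2" using 1(3) 2(3) by (auto simp: e_def)
  have J: "finite J" "J \<subseteq> I" using 1 2 by (auto simp: J_def)
  have small: "p i (x \<otimes>\<^bsub>M\<^esub> y) < 1"
    if "x \<in> carrier M" "y \<in> carrier M" "\<forall>j\<in>J. p j x \<le> e" "\<forall>j\<in>J. p j y \<le> e" for x y
  proof -
    have "p j (x \<ominus>\<^bsub>M\<^esub> \<zero>\<^bsub>M\<^esub>) < e1" if "j \<in> J1" for j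
    proof -
      have "p j x \<le> e" using that \<open>\<forall>j\<in>J. p j x \<le> e\<close> by (simp add: J_def)
      then show ?thesis using e m0[OF \<open>x \<in> carrier M\<close>] by simp
    qed
    then have "x \<in> U1" using 1(4) that(1) by blast
    have "p j (y \<ominus>\<^bsub>M\<^esub> \<zero>\<^bsub>M\<^esub>) < e2" if "j \<in> J2" for j
    proof -
      have "p j y \<le> e" using that \<open>\<forall>j\<in>J. p j y \<le> e\<close> by (simp add: J_def)
      then show ?thesis using e m0[OF \<open>y \<in> carrier M\<close>] by simp
    qed
    then have "y \<in> U2" using 2(4) that(2) by blast
    with \<open>x \<in> U1\<close> U(5) show ?thesis by auto
  qed
  define C where "C = 1 / e\<^sup>2"
  have bound: "p i (x \<otimes>\<^bsub>M\<^esub> y) \<le> C * ((\<Sum>j\<in>J. p j x) * (\<Sum>j\<in>J. p j y))"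
    if x: "x \<in> carrier M" and y: "y \<in> carrier M" for x y
  proof -
    define a where "a = (\<Sum>j\<in>J. p j x)"
    define b where "b = (\<Sum>j\<in>J. p j y)"
    have ab: "0 \<le> a" "0 \<le> b" "\<And>j. j \<in> J \<Longrightarrow> p j x \<le> a" "\<And>j. j \<in> J \<Longrightarrow> p j y \<le> b"
      unfolding a_def b_def using J pn x y by (auto intro!: sum_nonneg member_le_sum)
    have le: "p i (x \<otimes>\<^bsub>M\<^esub> y) \<le> C * ((a + d) * (b + d))" if d: "0 < d" for d
    proof -
      define s where "s = e / (a + d)"
      define r where "r = e / (b + d)"
      have pos: "0 < s" "0 < r" using e ab d by (auto simp: s_def r_def)
      have "s * p j x \<le> e" if "j \<in> J" for j
        using ab(3)[OF that] ab(1) d e by (simp add: s_def field_simps)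
          (smt (verit) mult_left_mono mult.commute mult_nonneg_nonneg)
      moreover have "r * p j y \<le> e" if "j \<in> J" for j
        using ab(4)[OF that] ab(2) d e by (simp add: r_def field_simps)
          (smt (verit) mult_left_mono mult.commute mult_nonneg_nonneg)
      ultimately have "p i ((of_real s \<odot>\<^bsub>M\<^esub> x) \<otimes>\<^bsub>M\<^esub> (of_real r \<odot>\<^bsub>M\<^esub> y)) < 1"
        using psc J(2) x y pos c(4) by (intro small) (auto simp: subset_iff)
      also have "(of_real s \<odot>\<^bsub>M\<^esub> x) \<otimes>\<^bsub>M\<^esub> (of_real r \<odot>\<^bsub>M\<^esub> y) = of_real s \<odot>\<^bsub>M\<^esub> (of_real r \<odot>\<^bsub>M\<^esub> (x \<otimes>\<^bsub>M\<^esub> y))"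
        by (simp only: t(5)[OF x c(4)[OF y]] t(6)[OF x y])
      also have "p i \<dots> = s * r * p i (x \<otimes>\<^bsub>M\<^esub> y)"
        using psc[OF i] c(4) t(2) x y pos by simp
      finally have "s * r * p i (x \<otimes>\<^bsub>M\<^esub> y) \<le> 1" by simp
      then have "p i (x \<otimes>\<^bsub>M\<^esub> y) \<le> 1 / (s * r)" using pos by (simp add: field_simps)
      also have "\<dots> = C * ((a + d) * (b + d))"
        by (simp add: s_def r_def C_def power2_eq_square)
      finally show ?thesis .
    qed
    have "((\<lambda>d. C * ((a + d) * (b + d))) \<longlongrightarrow> C * ((a + 0) * (b + 0))) (at_right 0)"
      by (intro tendsto_intros)
    then have "p i (x \<otimes>\<^bsub>M\<^esub> y) \<le> C * ((a + 0) * (b + 0))"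
      by (rule tendsto_lowerbound) (auto simp: eventually_at_right_less le intro: eventually_mono[OF eventually_at_right_less])
    then show ?thesis by (simp add: a_def b_def)
  qed
  show ?thesis by (rule that[OF J _ bound]) (auto simp: C_def)
qed

lemma asymptotic_settingD:
  fixes S :: "('x, 'l::order, 'k::real_normed_field, 'e, 'f, 'i) setting"
  assumes "asymptotic_setting S"
  shows "unital_subring (nets S)" "solid (nets S)" "net_ideal (null_nets S) (nets S)"
    "solid (null_nets S)" "alg_presheaf (base S) (shE S)"
    "seminorm_system (base S) (shE S) (idx S) (semi S)" "alg_presheaf (base S) (shF S)"
    "\<And>V. openin (base S) V \<Longrightarrow> top_alg_hom (sec (shE S) V) (sec (shF S) V) (emb S V)"
    "\<And>V v. openin (base S) V \<Longrightarrow> v \<in> negligible_nets S V \<Longrightarrow> net_limit S V v \<zero>\<^bsub>sec (shF S) V\<^esub>"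
    "\<And>r. 0 \<le> r \<Longrightarrow> (\<lambda>l. of_real (scl S r l)) \<in> nets S"
    "\<And>r l. 0 \<le> r \<Longrightarrow> 0 \<le> scl S r l" "\<And>l. scl S 0 l = 1"
proof -
  note A = assms[unfolded asymptotic_setting_def alg_sheaf_def]
  show "unital_subring (nets S)" "solid (nets S)" "net_ideal (null_nets S) (nets S)"
    "solid (null_nets S)" "alg_presheaf (base S) (shE S)"
    "seminorm_system (base S) (shE S) (idx S) (semi S)" "alg_presheaf (base S) (shF S)"
    using A by simp_all
  show "top_alg_hom (sec (shE S) V) (sec (shF S) V) (emb S V)" if "openin (base S) V" for V
    using A that by simp
  show "net_limit S V v \<zero>\<^bsub>sec (shF S) V\<^esub>"
    if "openin (base S) V" "v \<in> negligible_nets S V" for V v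
    using A that by simp
  show "(\<lambda>l. of_real (scl S r l)) \<in> nets S" if "0 \<le> r" for r
    using A that by simp
  show "0 \<le> scl S r l" if "0 \<le> r" for r l
    using A that by simp
  show "scl S 0 l = 1" for l
    using A by simp
qed

lemma alg_presheafD:
  assumes "alg_presheaf X F" "openin X V"
  shows "topological_algebra (sec F V)"
    "\<And>W. openin X W \<Longrightarrow> W \<subseteq> V \<Longrightarrow> top_alg_hom (sec F V) (sec F W) (res F V W)"
  using assms by (simp_all add: alg_presheaf_def)

lemma seminorm_systemD:
  assumes "seminorm_system X E I p" "openin X V"
  shows "\<forall>i\<in>I V. seminorm_on (sec E V) (p V i)"
    "topology_from_seminorms (sec E V) (I V) (p V)"
    "\<And>W. openin X W \<Longrightarrow> W \<subseteq> V \<Longrightarrow> I W \<subseteq> I V"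
    "\<And>W i u. openin X W \<Longrightarrow> W \<subseteq> V \<Longrightarrow> i \<in> I W \<Longrightarrow> u \<in> carrier (sec E V) \<Longrightarrow>
       p V i u = p W i (res E V W u)"
proof -
  note A = assms(1)[unfolded seminorm_system_def]
  show "\<forall>i\<in>I V. seminorm_on (sec E V) (p V i)" "topology_from_seminorms (sec E V) (I V) (p V)"
    using A[THEN conjunct1] assms(2) by simp_all
  note B = A[THEN conjunct2, THEN conjunct1, rule_format]
  show "I W \<subseteq> I V" if "openin X W" "W \<subseteq> V" for W
    using B[of V W] assms(2) that by simp
  show "p V i u = p W i (res E V W u)"
    if "openin X W" "W \<subseteq> V" "i \<in> I W" "u \<in> carrier (sec E V)" for W i u
    using conjunct2[OF B[of V W]] assms(2) that by blast
qed

lemma top_alg_homD: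
  assumes "top_alg_hom M N h"
  shows "\<And>x. x \<in> carrier M \<Longrightarrow> h x \<in> carrier N"
    "\<And>x y. x \<in> carrier M \<Longrightarrow> y \<in> carrier M \<Longrightarrow> h (x \<oplus>\<^bsub>M\<^esub> y) = h x \<oplus>\<^bsub>N\<^esub> h y"
  using assms by (auto simp: top_alg_hom_def)

lemma sections:
  assumes "asymptotic_setting S" "openin (base S) V"
  shows "topological_algebra (sec (shE S) V)" "topological_algebra (sec (shF S) V)"
    "\<forall>i\<in>idx S V. seminorm_on (sec (shE S) V) (semi S V i)"
    "topology_from_seminorms (sec (shE S) V) (idx S V) (semi S V)"
  by (rule alg_presheafD(1)[OF asymptotic_settingD(5)[OF assms(1)] assms(2)])
     (rule alg_presheafD(1)[OF asymptotic_settingD(7)[OF assms(1)] assms(2)]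
           seminorm_systemD(1,2)[OF asymptotic_settingD(6)[OF assms(1)] assms(2)])+

lemma net_set_dominated:
  assumes "solid B" "\<And>l. w l \<in> carrier M" "\<forall>i\<in>I. seminorm_on M (p i)"
    "\<And>i. i \<in> I \<Longrightarrow> \<exists>f\<in>abs_nets B. \<forall>l. p i (w l) \<le> f l"
  shows "\<forall>i\<in>I. (\<lambda>l. p i (w l)) \<in> abs_nets B"
proof
  fix i assume i: "i \<in> I"
  then obtain f where f: "f \<in> abs_nets B" "\<And>l. p i (w l) \<le> f l" using assms(4) by blast
  show "(\<lambda>l. p i (w l)) \<in> abs_nets B"
    by (rule abs_nets_mono[OF assms(1) f(1) _ f(2)]) (use assms(2,3) i in \<open>auto simp: seminorm_on_def\<close>)
qed

lemma null_nets_moderate: "asymptotic_setting S \<Longrightarrow> negligible_nets S V \<subseteq> moderate_nets S V"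
  using asymptotic_settingD(3)[of S]
  by (fastforce simp: net_ideal_def negligible_nets_def moderate_nets_def abs_nets_def)

lemma negligible_add:
  assumes S: "asymptotic_setting S" and V: "openin (base S) V"
    and uv: "u \<in> negligible_nets S V" "v \<in> negligible_nets S V"
  shows "(\<lambda>l. u l \<oplus>\<^bsub>sec (shE S) V\<^esub> v l) \<in> negligible_nets S V"
proof -
  note s = sections[OF S V] and d = asymptotic_settingD[OF S]
  have c: "u l \<in> carrier (sec (shE S) V)" "v l \<in> carrier (sec (shE S) V)" for l
    using uv by (auto simp: negligible_nets_def)
  have "\<exists>f\<in>abs_nets (null_nets S). \<forall>l. semi S V i (u l \<oplus>\<^bsub>sec (shE S) V\<^esub> v l) \<le> f l"
    if i: "i \<in> idx S V" for i
  proof (rule bexI)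
    show "\<forall>l. semi S V i (u l \<oplus>\<^bsub>sec (shE S) V\<^esub> v l) \<le> semi S V i (u l) + semi S V i (v l)"
      using s(3) i c by (simp add: seminorm_on_def)
    show "(\<lambda>l. semi S V i (u l) + semi S V i (v l)) \<in> abs_nets (null_nets S)"
      using uv i by (intro abs_nets_add[OF d(3,4)]) (auto simp: negligible_nets_def)
  qed
  then have "\<forall>i\<in>idx S V. (\<lambda>l. semi S V i (u l \<oplus>\<^bsub>sec (shE S) V\<^esub> v l)) \<in> abs_nets (null_nets S)"
    using net_set_dominated[OF d(4) _ s(3), of "\<lambda>l. u l \<oplus>\<^bsub>sec (shE S) V\<^esub> v l"] c module_closed(2)[OF s(1)] by blast
  then show ?thesis using c module_closed(2)[OF s(1)] by (simp add: negligible_nets_def)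
qed

lemma negligible_uminus:
  assumes S: "asymptotic_setting S" and V: "openin (base S) V"
    and c: "\<And>l. u l \<in> carrier (sec (shE S) V)" "\<And>l. v l \<in> carrier (sec (shE S) V)"
    and uv: "(\<lambda>l. u l \<ominus>\<^bsub>sec (shE S) V\<^esub> v l) \<in> negligible_nets S V"
  shows "(\<lambda>l. v l \<ominus>\<^bsub>sec (shE S) V\<^esub> u l) \<in> negligible_nets S V"
  using uv sections[OF S V] c seminorm_facts(3)[OF sections(1)[OF S V]]
    module_closed(3)[OF sections(1)[OF S V]]
  by (simp add: negligible_nets_def)

lemma moderate_mult:
  assumes S: "asymptotic_setting S" and V: "openin (base S) V"
    and u: "u \<in> moderate_nets S V" and v: "v \<in> moderate_nets S V"
  shows "(\<lambda>l. u l \<otimes>\<^bsub>sec (shE S) V\<^esub> v l) \<in> moderate_nets S V"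
    and "u \<in> negligible_nets S V \<or> v \<in> negligible_nets S V \<Longrightarrow>
      (\<lambda>l. u l \<otimes>\<^bsub>sec (shE S) V\<^esub> v l) \<in> negligible_nets S V"
proof -
  note s = sections[OF S V] and d = asymptotic_settingD[OF S]
  let ?M = "sec (shE S) V"
  note self = net_ideal_self[OF d(1)]
  have c: "u l \<in> carrier ?M" "v l \<in> carrier ?M" for l
    using u v by (auto simp: moderate_nets_def)
  have m: "u l \<otimes>\<^bsub>?M\<^esub> v l \<in> carrier ?M" for l using topological_algebraD(2)[OF s(1)] c by blast
  have gen: "\<forall>i\<in>idx S V. (\<lambda>l. semi S V i (u l \<otimes>\<^bsub>?M\<^esub> v l)) \<in> abs_nets B"
    if B: "net_ideal B (nets S)" "solid B"
      and w: "(\<forall>i\<in>idx S V. (\<lambda>l. semi S V i (u l)) \<in> abs_nets B) \<or>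
              (\<forall>i\<in>idx S V. (\<lambda>l. semi S V i (v l)) \<in> abs_nets B)" for B
  proof (rule net_set_dominated[OF B(2) m s(3)])
    fix i assume "i \<in> idx S V"
    from seminorm_mult_bound[OF s(1,3,4) this]
    obtain J C where J: "finite J" "J \<subseteq> idx S V" "0 \<le> C"
      "\<And>x y. x \<in> carrier ?M \<Longrightarrow> y \<in> carrier ?M \<Longrightarrow>
       semi S V i (x \<otimes>\<^bsub>?M\<^esub> y) \<le> C * ((\<Sum>j\<in>J. semi S V j x) * (\<Sum>j\<in>J. semi S V j y))"
      by blast
    have A: "(\<lambda>l. \<Sum>j\<in>J. semi S V j (u l)) \<in> abs_nets (nets S)"
      "(\<lambda>l. \<Sum>j\<in>J. semi S V j (v l)) \<in> abs_nets (nets S)"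
      using u v J by (auto simp: moderate_nets_def intro!: abs_nets_sum[OF self d(2)])
    have "(\<lambda>l. (\<Sum>j\<in>J. semi S V j (u l)) * (\<Sum>j\<in>J. semi S V j (v l))) \<in> abs_nets B"
      using w
    proof
      assume "\<forall>i\<in>idx S V. (\<lambda>l. semi S V i (u l)) \<in> abs_nets B"
      then have "(\<lambda>l. \<Sum>j\<in>J. semi S V j (u l)) \<in> abs_nets B"
        using J by (intro abs_nets_sum[OF B]) auto
      from abs_nets_mult[OF B d(2) A(2) this] show ?thesis by (simp add: mult.commute)
    next
      assume "\<forall>i\<in>idx S V. (\<lambda>l. semi S V i (v l)) \<in> abs_nets B"
      then have "(\<lambda>l. \<Sum>j\<in>J. semi S V j (v l)) \<in> abs_nets B"
        using J by (intro abs_nets_sum[OF B]) auto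
      from abs_nets_mult[OF B d(2) A(1) this] show ?thesis .
    qed
    from abs_nets_mult[OF B d(2) abs_nets_const[OF d(1,2) J(3)] this]
    show "\<exists>f\<in>abs_nets B. \<forall>l. semi S V i (u l \<otimes>\<^bsub>?M\<^esub> v l) \<le> f l"
      using J(4)[OF c(1) c(2)] by (intro bexI[where x = "\<lambda>l. C * ((\<Sum>j\<in>J. semi S V j (u l)) * (\<Sum>j\<in>J. semi S V j (v l)))"]) auto
  qed
  show "(\<lambda>l. u l \<otimes>\<^bsub>?M\<^esub> v l) \<in> moderate_nets S V"
    using gen[OF self d(2)] u m by (auto simp: moderate_nets_def)
  show "(\<lambda>l. u l \<otimes>\<^bsub>?M\<^esub> v l) \<in> negligible_nets S V"
    if "u \<in> negligible_nets S V \<or> v \<in> negligible_nets S V"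
    using gen[OF d(3,4)] that m by (auto simp: negligible_nets_def)
qed

lemma equiv_gen_rel:
  assumes S: "asymptotic_setting S" and V: "openin (base S) V"
  shows "equiv (moderate_nets S V) (gen_rel S V)"
proof (rule equivI)
  note s = sections[OF S V] and d = asymptotic_settingD[OF S]
  let ?M = "sec (shE S) V"
  interpret module scalar_ring ?M by (rule topological_algebraD(1)[OF s(1)])
  show "gen_rel S V \<subseteq> moderate_nets S V \<times> moderate_nets S V" by (auto simp: gen_rel_def)
  show "refl_on (moderate_nets S V) (gen_rel S V)"
  proof (rule refl_onI)
    fix u assume u: "u \<in> moderate_nets S V"
    then have "(\<lambda>l. u l \<ominus>\<^bsub>?M\<^esub> u l) = (\<lambda>l. \<zero>\<^bsub>?M\<^esub>)"
      by (auto simp: moderate_nets_def a_minus_def M.r_neg)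
    moreover have "(\<lambda>l. \<zero>\<^bsub>?M\<^esub>) \<in> negligible_nets S V"
    proof -
      have "semi S V i \<zero>\<^bsub>?M\<^esub> = 0" if "i \<in> idx S V" for i
        using seminorm_facts(1)[OF s(1)] s(3) that by blast
      then show ?thesis using abs_nets_zero[OF d(3,4)] by (simp add: negligible_nets_def)
    qed
    ultimately show "(u, u) \<in> gen_rel S V" using u by (simp add: gen_rel_def)
  qed
  show "sym (gen_rel S V)"
    by (rule symI) (auto simp: gen_rel_def moderate_nets_def intro: negligible_uminus[OF S V])
  show "trans (gen_rel S V)"
  proof (rule transI)
    fix u v w assume uv: "(u, v) \<in> gen_rel S V" and vw: "(v, w) \<in> gen_rel S V"
    then have c: "u l \<in> carrier ?M" "v l \<in> carrier ?M" "w l \<in> carrier ?M" for l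
      by (auto simp: gen_rel_def moderate_nets_def)
    have "u l \<ominus>\<^bsub>?M\<^esub> w l = (u l \<ominus>\<^bsub>?M\<^esub> v l) \<oplus>\<^bsub>?M\<^esub> (v l \<ominus>\<^bsub>?M\<^esub> w l)" for l
      using c[of l] by (simp add: a_minus_def M.a_assoc M.r_neg1)
    then show "(u, w) \<in> gen_rel S V"
      using uv vw negligible_add[OF S V, of "\<lambda>l. u l \<ominus>\<^bsub>?M\<^esub> v l" "\<lambda>l. v l \<ominus>\<^bsub>?M\<^esub> w l"]
      by (auto simp: gen_rel_def)
  qed
qed

lemma gen_mult_class:
  assumes S: "asymptotic_setting S" and V: "openin (base S) V"
    and u: "u \<in> moderate_nets S V" and v: "v \<in> moderate_nets S V"
  shows "gen_mult S V (gen_rel S V `` {u}) (gen_rel S V `` {v}) =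
         gen_rel S V `` {\<lambda>l. u l \<otimes>\<^bsub>sec (shE S) V\<^esub> v l}"
proof -
  let ?M = "sec (shE S) V"
  note s = sections[OF S V] and e = equiv_gen_rel[OF S V]
  note a = topological_algebraD[OF s(1)] and mc = module_closed[OF s(1)]
  interpret module scalar_ring ?M by (rule a(1))
  have "gen_rel S V `` {\<lambda>l. u' l \<otimes>\<^bsub>?M\<^esub> v' l} = gen_rel S V `` {\<lambda>l. u l \<otimes>\<^bsub>?M\<^esub> v l}"
    if u': "(u, u') \<in> gen_rel S V" and v': "(v, v') \<in> gen_rel S V" for u' v'
  proof -
    have m: "u' \<in> moderate_nets S V" "v' \<in> moderate_nets S V"
      and n: "(\<lambda>l. u l \<ominus>\<^bsub>?M\<^esub> u' l) \<in> negligible_nets S V"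
        "(\<lambda>l. v l \<ominus>\<^bsub>?M\<^esub> v' l) \<in> negligible_nets S V"
      using u' v' by (auto simp: gen_rel_def)
    have c: "u l \<in> carrier ?M" "v l \<in> carrier ?M" "u' l \<in> carrier ?M" "v' l \<in> carrier ?M" for l
      using u v m by (auto simp: moderate_nets_def)
    have "u l \<otimes>\<^bsub>?M\<^esub> v l \<ominus>\<^bsub>?M\<^esub> u' l \<otimes>\<^bsub>?M\<^esub> v' l =
        (u l \<ominus>\<^bsub>?M\<^esub> u' l) \<otimes>\<^bsub>?M\<^esub> v l \<oplus>\<^bsub>?M\<^esub> u' l \<otimes>\<^bsub>?M\<^esub> (v l \<ominus>\<^bsub>?M\<^esub> v' l)" for l
    proof -
      have neg: "(\<ominus>\<^bsub>?M\<^esub> u' l) \<otimes>\<^bsub>?M\<^esub> v l = \<ominus>\<^bsub>?M\<^esub> (u' l \<otimes>\<^bsub>?M\<^esub> v l)"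
        "u' l \<otimes>\<^bsub>?M\<^esub> (\<ominus>\<^bsub>?M\<^esub> v' l) = \<ominus>\<^bsub>?M\<^esub> (u' l \<otimes>\<^bsub>?M\<^esub> v' l)"
        using mc(6) a(2,5,6) c by simp_all
      show ?thesis
        using c[of l] a(2)
        by (simp add: a_minus_def a(3,4) neg M.a_assoc M.r_neg1)
    qed
    moreover have "(\<lambda>l. (u l \<ominus>\<^bsub>?M\<^esub> u' l) \<otimes>\<^bsub>?M\<^esub> v l \<oplus>\<^bsub>?M\<^esub> u' l \<otimes>\<^bsub>?M\<^esub> (v l \<ominus>\<^bsub>?M\<^esub> v' l)) \<in> negligible_nets S V"
      using n null_nets_moderate[OF S, of V] m u v
      by (intro negligible_add[OF S V] moderate_mult(2)[OF S V]) auto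
    ultimately have "(\<lambda>l. u l \<otimes>\<^bsub>?M\<^esub> v l, \<lambda>l. u' l \<otimes>\<^bsub>?M\<^esub> v' l) \<in> gen_rel S V"
      using moderate_mult(1)[OF S V] u v m by (simp add: gen_rel_def)
    then show ?thesis by (rule equiv_class_eq[OF e, symmetric])
  qed
  then have "gen_mult S V (gen_rel S V `` {u}) (gen_rel S V `` {v}) =
      (\<Union>u'\<in>gen_rel S V `` {u}. \<Union>v'\<in>gen_rel S V `` {v}.
         gen_rel S V `` {\<lambda>l. u l \<otimes>\<^bsub>?M\<^esub> v l})"
    unfolding gen_mult_def by (intro SUP_cong refl) simp
  moreover have "(u, u) \<in> gen_rel S V" "(v, v) \<in> gen_rel S V"
    using e u v by (auto simp: equiv_def refl_on_def)
  ultimately show ?thesis by auto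
qed

lemma net_limit_representative:
  fixes S :: "('x, 'l::order, 'k::real_normed_field, 'e, 'f, 'i) setting"
  assumes S: "asymptotic_setting S" and O: "openin (base S) \<Omega>" and V: "openin (base S) V" "V \<subseteq> \<Omega>"
    and uw: "(u, w) \<in> gen_rel S \<Omega>" and r: "0 \<le> r"
    and lim: "net_limit S V (\<lambda>l. of_real (scl S r l) \<odot>\<^bsub>sec (shE S) V\<^esub> res (shE S) \<Omega> V (w l)) f"
  shows "net_limit S V (\<lambda>l. of_real (scl S r l) \<odot>\<^bsub>sec (shE S) V\<^esub> res (shE S) \<Omega> V (u l)) f"
proof -
  let ?M = "sec (shE S) \<Omega>" and ?N = "sec (shE S) V" and ?F = "sec (shF S) V"
  note d = asymptotic_settingD[OF S] and s = sections[OF S V(1)] and so = sections[OF S O]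
  note mc = module_closed[OF s(1)] and mo = module_closed[OF so(1)]
  interpret N: module scalar_ring ?N by (rule topological_algebraD(1)[OF s(1)])
  interpret M: module scalar_ring ?M by (rule topological_algebraD(1)[OF so(1)])
  interpret F: module scalar_ring ?F by (rule topological_algebraD(1)[OF s(2)])
  have c: "u l \<in> carrier ?M" "w l \<in> carrier ?M" for l
    using uw by (auto simp: gen_rel_def moderate_nets_def)
  have rh: "top_alg_hom ?M ?N (res (shE S) \<Omega> V)"
    by (rule alg_presheafD(2)[OF d(5) O V])
  note rc = top_alg_homD(1)[OF rh]
  have eh: "top_alg_hom ?N ?F (emb S V)" by (rule d(8)[OF V(1)])
  note sn = seminorm_systemD(3,4)[OF d(6) O V]
  define z where "z = (\<lambda>l. of_real (scl S r l) \<odot>\<^bsub>?N\<^esub> res (shE S) \<Omega> V (u l \<ominus>\<^bsub>?M\<^esub> w l))"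
  have zc: "z l \<in> carrier ?N" for l using c mo(3) rc mc(4) by (simp add: z_def)
  have "z \<in> negligible_nets S V"
  proof -
    have "(\<lambda>l. semi S V i (z l)) \<in> abs_nets (null_nets S)" if i: "i \<in> idx S V" for i
    proof -
      have "(\<lambda>l. semi S \<Omega> i (u l \<ominus>\<^bsub>?M\<^esub> w l)) \<in> abs_nets (null_nets S)"
        using uw i sn(1) by (auto simp: gen_rel_def negligible_nets_def)
      moreover have "scl S r \<in> abs_nets (nets S)"
        using d(10,11)[OF r] by (simp add: abs_nets_iff[OF d(2)])
      ultimately have "(\<lambda>l. scl S r l * semi S \<Omega> i (u l \<ominus>\<^bsub>?M\<^esub> w l)) \<in> abs_nets (null_nets S)"
        using abs_nets_mult[OF d(3,4,2)] by blast
      moreover have "semi S V i (z l) = scl S r l * semi S \<Omega> i (u l \<ominus>\<^bsub>?M\<^esub> w l)" for l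
        using s(3) i rc[OF mo(3)[OF c]] sn(2)[OF i mo(3)[OF c]] d(11)[OF r]
        unfolding z_def seminorm_on_def by simp
      ultimately show ?thesis by simp
    qed
    with zc show ?thesis by (simp add: negligible_nets_def)
  qed
  from d(9)[OF V(1) this]
  have lz: "limitin (tops ?F) (\<lambda>l. emb S V (z l)) \<zero>\<^bsub>?F\<^esub> at_bot" by (simp add: net_limit_def)
  let ?w = "\<lambda>l. of_real (scl S r l) \<odot>\<^bsub>?N\<^esub> res (shE S) \<Omega> V (w l)"
  have "limitin (prod_topology (tops ?F) (tops ?F)) (\<lambda>l. (emb S V (?w l), emb S V (z l))) (f, \<zero>\<^bsub>?F\<^esub>) at_bot"
    using lim lz by (simp add: limitin_pairwise net_limit_def o_def)
  from continuous_map_limit[OF topological_algebraD(8)[OF s(2)] this]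
  have "limitin (tops ?F) (\<lambda>l. emb S V (?w l) \<oplus>\<^bsub>?F\<^esub> emb S V (z l)) (f \<oplus>\<^bsub>?F\<^esub> \<zero>\<^bsub>?F\<^esub>) at_bot"
    by (simp add: o_def)
  moreover have "f \<in> carrier ?F"
    using lim topological_algebraD(7)[OF s(2)] by (simp add: net_limit_def limitin_def)
  moreover have "emb S V (?w l) \<oplus>\<^bsub>?F\<^esub> emb S V (z l) =
      emb S V (of_real (scl S r l) \<odot>\<^bsub>?N\<^esub> res (shE S) \<Omega> V (u l))" for l
  proof -
    have "u l = w l \<oplus>\<^bsub>?M\<^esub> (u l \<ominus>\<^bsub>?M\<^esub> w l)"
      using c[of l] by (simp add: a_minus_def M.M.a_lcomm M.M.r_neg)
    then have "res (shE S) \<Omega> V (u l) =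
        res (shE S) \<Omega> V (w l) \<oplus>\<^bsub>?N\<^esub> res (shE S) \<Omega> V (u l \<ominus>\<^bsub>?M\<^esub> w l)"
      using top_alg_homD(2)[OF rh c(2) mo(3)[OF c]] by metis
    then have "of_real (scl S r l) \<odot>\<^bsub>?N\<^esub> res (shE S) \<Omega> V (u l) = ?w l \<oplus>\<^bsub>?N\<^esub> z l"
      using N.smult_r_distr rc c mo(3) by (simp add: z_def)
    moreover have "emb S V (?w l \<oplus>\<^bsub>?N\<^esub> z l) = emb S V (?w l) \<oplus>\<^bsub>?F\<^esub> emb S V (z l)"
      by (rule top_alg_homD(2)[OF eh mc(4)[OF rc[OF c(2)]] zc])
    ultimately show ?thesis by simp
  qed
  ultimately show ?thesis by (simp add: net_limit_def)
qed

lemma gen_rel_refl: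
  assumes "asymptotic_setting S" "openin (base S) \<Omega>" "u \<in> moderate_nets S \<Omega>"
  shows "(u, u) \<in> gen_rel S \<Omega>"
  using equiv_gen_rel[OF assms(1,2)] assms(3) by (auto simp: equiv_def refl_on_def)

lemma conv_exps_class:
  assumes S: "asymptotic_setting S" and O: "openin (base S) \<Omega>" and u: "u \<in> moderate_nets S \<Omega>"
  shows "conv_exps S \<Omega> (gen_rel S \<Omega> `` {u}) x = {r. 0 \<le> r \<and> (\<exists>V\<in>open_nbhds S \<Omega> x. \<exists>f.
     net_limit S V (\<lambda>l. of_real (scl S r l) \<odot>\<^bsub>sec (shE S) V\<^esub> res (shE S) \<Omega> V (u l)) f)}"
proof -
  have "(\<exists>w\<in>gen_rel S \<Omega> `` {u}. \<exists>V\<in>open_nbhds S \<Omega> x. \<exists>f.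
      net_limit S V (\<lambda>l. of_real (scl S r l) \<odot>\<^bsub>sec (shE S) V\<^esub> res (shE S) \<Omega> V (w l)) f) \<longleftrightarrow>
    (\<exists>V\<in>open_nbhds S \<Omega> x. \<exists>f.
      net_limit S V (\<lambda>l. of_real (scl S r l) \<odot>\<^bsub>sec (shE S) V\<^esub> res (shE S) \<Omega> V (u l)) f)"
    (is "?L \<longleftrightarrow> ?R") if r: "0 \<le> r" for r
  proof
    assume ?L
    then obtain w V f where w: "w \<in> gen_rel S \<Omega> `` {u}" and V: "V \<in> open_nbhds S \<Omega> x"
      and f: "net_limit S V (\<lambda>l. of_real (scl S r l) \<odot>\<^bsub>sec (shE S) V\<^esub> res (shE S) \<Omega> V (w l)) f"
      by (elim bexE exE)
    have "(u, w) \<in> gen_rel S \<Omega>" "openin (base S) V" "V \<subseteq> \<Omega>"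
      using w V by (simp_all add: open_nbhds_def)
    from net_limit_representative[OF S O this(2,3,1) r f] V show ?R by (intro bexI exI)
  next
    assume ?R
    moreover have "u \<in> gen_rel S \<Omega> `` {u}" using gen_rel_refl[OF S O u] by simp
    ultimately show ?L by (rule bexI[where x = u])
  qed
  then show ?thesis by (simp add: conv_exps_def cong: conj_cong)
qed

lemma F_sing_supp_class:
  fixes S :: "('x, 'l::order, 'k::real_normed_field, 'e, 'f, 'i) setting"
  assumes S: "asymptotic_setting S" and O: "openin (base S) \<Omega>" and u: "u \<in> moderate_nets S \<Omega>"
  shows "F_sing_supp S \<Omega> (gen_rel S \<Omega> `` {u}) = {x\<in>\<Omega>. \<not> (\<exists>V\<in>open_nbhds S \<Omega> x. \<exists>f.
     net_limit S V (\<lambda>l. res (shE S) \<Omega> V (u l)) f)}"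
proof -
  have res_one: "(\<lambda>l. of_real (scl S 0 l) \<odot>\<^bsub>sec (shE S) V\<^esub> res (shE S) \<Omega> V (w l)) =
      (\<lambda>l. res (shE S) \<Omega> V (w l))"
    if "w \<in> moderate_nets S \<Omega>" "V \<in> open_nbhds S \<Omega> x" for w V x
  proof
    fix l
    have V: "openin (base S) V" "V \<subseteq> \<Omega>" using that(2) by (simp_all add: open_nbhds_def)
    interpret N: module scalar_ring "sec (shE S) V"
      by (rule topological_algebraD(1)[OF sections(1)[OF S V(1)]])
    have "w l \<in> carrier (sec (shE S) \<Omega>)" using that(1) by (simp add: moderate_nets_def)
    from top_alg_homD(1)[OF alg_presheafD(2)[OF asymptotic_settingD(5)[OF S] O V] this]
    show "of_real (scl S 0 l) \<odot>\<^bsub>sec (shE S) V\<^esub> res (shE S) \<Omega> V (w l) = res (shE S) \<Omega> V (w l)"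
      using N.smult_one by (simp add: asymptotic_settingD(12)[OF S])
  qed
  have mod: "w \<in> moderate_nets S \<Omega>" if "w \<in> gen_rel S \<Omega> `` {u}" for w
    using that by (simp add: gen_rel_def)
  have "0 \<in> conv_exps S \<Omega> (gen_rel S \<Omega> `` {u}) x \<longleftrightarrow>
      (\<exists>w\<in>gen_rel S \<Omega> `` {u}. \<exists>V\<in>open_nbhds S \<Omega> x. \<exists>f.
         net_limit S V (\<lambda>l. res (shE S) \<Omega> V (w l)) f)" for x
  proof -
    have "(\<exists>f. net_limit S V (\<lambda>l. of_real (scl S 0 l) \<odot>\<^bsub>sec (shE S) V\<^esub> res (shE S) \<Omega> V (w l)) f) \<longleftrightarrow>
        (\<exists>f. net_limit S V (\<lambda>l. res (shE S) \<Omega> V (w l)) f)"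
      if "w \<in> gen_rel S \<Omega> `` {u}" "V \<in> open_nbhds S \<Omega> x" for w V
      by (simp only: res_one[OF mod[OF that(1)] that(2)])
    then show ?thesis unfolding conv_exps_def mem_Collect_eq
      by (simp del: Image_singleton_iff cong: bex_cong)
  qed
  moreover have "0 \<in> conv_exps S \<Omega> (gen_rel S \<Omega> `` {u}) x \<longleftrightarrow>
      (\<exists>V\<in>open_nbhds S \<Omega> x. \<exists>f. net_limit S V (\<lambda>l. res (shE S) \<Omega> V (u l)) f)" for x
  proof -
    have "(\<exists>f. net_limit S V (\<lambda>l. of_real (scl S 0 l) \<odot>\<^bsub>sec (shE S) V\<^esub> res (shE S) \<Omega> V (u l)) f) \<longleftrightarrow>
        (\<exists>f. net_limit S V (\<lambda>l. res (shE S) \<Omega> V (u l)) f)" if "V \<in> open_nbhds S \<Omega> x" for V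
      by (simp only: res_one[OF u that])
    then show ?thesis unfolding conv_exps_class[OF S O u] mem_Collect_eq
      by (simp cong: bex_cong)
  qed
  ultimately show ?thesis unfolding F_sing_supp_def by simp
qed

end

theory Submission
  imports Defs
begin

text \<open>
  Call a net of sections \<open>w\<close> convergent near \<open>x\<close> with scalar weights \<open>b\<close> if \<open>b\<^sub>l w\<^sub>l\<close> converges in
  \<open>\<F>(V)\<close> for some open neighbourhood \<open>V\<close> of \<open>x\<close>. Since restriction, multiplication and scalar
  multiplication of \<open>\<F>\<close> are continuous, this notion obeys a product rule: weights \<open>b\<close> for \<open>u\<close> and
  \<open>d\<close> for \<open>v\<close> give the weights \<open>b d\<close> for \<open>u v\<close> (\<open>converges_near_mult\<close>), and weights may be
  multiplied by any convergent scalar net (\<open>converges_near_scale\<close>). The membership \<open>r \<in> N\<^sub>x(u)\<close>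
  is convergence with weights \<open>a(r)\<close>, and \<open>x\<close> lies outside the singular support of \<open>u\<close> exactly
  when \<open>0 \<in> N\<^sub>x(u)\<close>.

  Submultiplicativity of \<open>a\<close> enters in one way only: if \<open>t > r + s\<close>, then
  \<open>a(t) = c a(r) a(s)\<close> with \<open>0 \<le> c \<le> a(t - r - s)\<close>, so \<open>c\<close> tends to \<open>0\<close> (\<open>scl_factor\<close>). Hence
  \<open>r \<in> N\<^sub>x(u)\<close> and \<open>s \<in> N\<^sub>x(v)\<close> force \<open>t \<in> N\<^sub>x(u v)\<close> for every \<open>t > r + s\<close>, and \<open>N\<^sub>x(u)\<close> is closed
  upwards. So \<open>\<Sigma>\<^sub>x(u)\<close> is an initial segment of \<open>\<real>\<^sub>+\<close>: it is all of \<open>\<real>\<^sub>+\<close> or bounded, and in the latter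
  case everything beyond its supremum belongs to \<open>N\<^sub>x(u)\<close>.

  If \<open>x\<close> is outside one singular support, say that of \<open>v\<close>, the product rule with weights \<open>1\<close> for
  \<open>v\<close> gives \<open>N\<^sub>x(u) \<subseteq> N\<^sub>x(u v)\<close>, which settles the first two sets, and, when \<open>x\<close> is
  outside both, gives \<open>N\<^sub>x(u v) = \<real>\<^sub>+\<close>. If \<open>x\<close> is in both and \<open>t\<close> exceeds
  \<open>sup \<Sigma>\<^sub>x(u) + sup \<Sigma>\<^sub>x(v)\<close>, there is room to choose \<open>r\<close> and \<open>s\<close> above the two suprema with
  \<open>r + s < t\<close>.
\<close>

section \<open>Convergence in the sheaf of limits\<close>

lemma continuous_map_limit2:
  assumes "continuous_map (prod_topology X Y) Z (\<lambda>(x, y). h x y)"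
    and "limitin X f a F" "limitin Y g b F"
  shows "limitin Z (\<lambda>l. h (f l) (g l)) (h a b) F"
proof -
  have "limitin (prod_topology X Y) (\<lambda>l. (f l, g l)) (a, b) F"
    using assms(2,3) by (simp add: limitin_pairwise o_def)
  from continuous_map_limit[OF assms(1) this] show ?thesis by (simp add: o_def)
qed

lemma net_limit_restrict:
  assumes S: "asymptotic_setting S" and V: "openin (base S) V" and W: "openin (base S) W" "W \<subseteq> V"
    and w: "\<And>l. w l \<in> carrier (sec (shE S) V)" and lim: "net_limit S V w f"
  shows "net_limit S W (\<lambda>l. res (shE S) V W (w l)) (res (shF S) V W f)"
proof -
  have "continuous_map (tops (sec (shF S) V)) (tops (sec (shF S) W)) (res (shF S) V W)"
    using alg_presheafD(2)[OF asymptotic_settingD(7)[OF S] V W] by (simp add: top_alg_hom_def)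
  from continuous_map_limit[OF this lim[unfolded net_limit_def]]
  have "limitin (tops (sec (shF S) W)) (\<lambda>l. res (shF S) V W (emb S V (w l))) (res (shF S) V W f) at_bot"
    by (simp add: o_def)
  moreover have "emb S W (res (shE S) V W (w l)) = res (shF S) V W (emb S V (w l))" for l
    using S V W w[of l] unfolding asymptotic_setting_def by simp
  ultimately show ?thesis by (simp add: net_limit_def)
qed

lemma net_limit_mult:
  assumes S: "asymptotic_setting S" and V: "openin (base S) V"
    and w: "\<And>l. w l \<in> carrier (sec (shE S) V)" "\<And>l. z l \<in> carrier (sec (shE S) V)"
    and lim: "net_limit S V w f" "net_limit S V z g"
  shows "net_limit S V (\<lambda>l. w l \<otimes>\<^bsub>sec (shE S) V\<^esub> z l) (f \<otimes>\<^bsub>sec (shF S) V\<^esub> g)"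
proof -
  have "emb S V (w l \<otimes>\<^bsub>sec (shE S) V\<^esub> z l) = emb S V (w l) \<otimes>\<^bsub>sec (shF S) V\<^esub> emb S V (z l)" for l
    using asymptotic_settingD(8)[OF S V] w by (simp add: top_alg_hom_def)
  with continuous_map_limit2[OF topological_algebraD(9)[OF sections(2)[OF S V]]
      lim[unfolded net_limit_def]]
  show ?thesis by (simp add: net_limit_def)
qed

lemma net_limit_scale:
  fixes S :: "('x, 'l::order, 'k::real_normed_field, 'e, 'f, 'i) setting" and c :: "'l \<Rightarrow> 'k"
  assumes S: "asymptotic_setting S" and V: "openin (base S) V"
    and w: "\<And>l. w l \<in> carrier (sec (shE S) V)"
    and c: "(c \<longlongrightarrow> d) at_bot" and lim: "net_limit S V w f"
  shows "net_limit S V (\<lambda>l. c l \<odot>\<^bsub>sec (shE S) V\<^esub> w l) (d \<odot>\<^bsub>sec (shF S) V\<^esub> f)"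
proof -
  have "continuous_map (prod_topology euclidean (tops (sec (shF S) V))) (tops (sec (shF S) V))
      (\<lambda>(c, x). c \<odot>\<^bsub>sec (shF S) V\<^esub> x)"
    using sections(2)[OF S V] unfolding topological_algebra_def by blast
  from continuous_map_limit2[OF this _ lim[unfolded net_limit_def], of c d]
  have "limitin (tops (sec (shF S) V)) (\<lambda>l. c l \<odot>\<^bsub>sec (shF S) V\<^esub> emb S V (w l))
      (d \<odot>\<^bsub>sec (shF S) V\<^esub> f) at_bot"
    using c by simp
  moreover have "emb S V (c l \<odot>\<^bsub>sec (shE S) V\<^esub> w l) = c l \<odot>\<^bsub>sec (shF S) V\<^esub> emb S V (w l)" for l
    using asymptotic_settingD(8)[OF S V] w by (simp add: top_alg_hom_def)
  ultimately show ?thesis by (simp add: net_limit_def)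
qed


section \<open>Local convergence of weighted nets\<close>

definition converges_near ::
    "('x, 'l::order, 'k::real_normed_field, 'e, 'f, 'i) setting \<Rightarrow> 'x set \<Rightarrow> 'x \<Rightarrow>
     ('l \<Rightarrow> real) \<Rightarrow> ('l \<Rightarrow> 'e) \<Rightarrow> bool" where
  "converges_near S \<Omega> x b w \<longleftrightarrow> (\<exists>V\<in>open_nbhds S \<Omega> x. \<exists>f.
     net_limit S V (\<lambda>l. of_real (b l) \<odot>\<^bsub>sec (shE S) V\<^esub> res (shE S) \<Omega> V (w l)) f)"

lemma converges_nearI:
  assumes "V \<in> open_nbhds S \<Omega> x"
    and "net_limit S V (\<lambda>l. of_real (b l) \<odot>\<^bsub>sec (shE S) V\<^esub> res (shE S) \<Omega> V (w l)) f"
  shows "converges_near S \<Omega> x b w"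
  unfolding converges_near_def using assms by (intro bexI[where x = V] exI[where x = f])

lemma res_closed:
  assumes "asymptotic_setting S" "openin (base S) V" "openin (base S) W" "W \<subseteq> V"
    and "w \<in> carrier (sec (shE S) V)"
  shows "res (shE S) V W w \<in> carrier (sec (shE S) W)"
  by (rule top_alg_homD(1)[OF alg_presheafD(2)[OF asymptotic_settingD(5)[OF assms(1)] assms(2-4)] assms(5)])

text \<open>
  Two nets may converge on different neighbourhoods of \<open>x\<close>; this moves each limit to the
  intersection.
\<close>

lemma weighted_net_limit_restrict:
  assumes S: "asymptotic_setting S" and O: "openin (base S) \<Omega>"
    and V: "openin (base S) V" "V \<subseteq> \<Omega>" and W: "openin (base S) W" "W \<subseteq> V"
    and w: "\<And>l. w l \<in> carrier (sec (shE S) \<Omega>)"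
    and lim: "net_limit S V (\<lambda>l. of_real (b l) \<odot>\<^bsub>sec (shE S) V\<^esub> res (shE S) \<Omega> V (w l)) f"
  shows "net_limit S W (\<lambda>l. of_real (b l) \<odot>\<^bsub>sec (shE S) W\<^esub> res (shE S) \<Omega> W (w l)) (res (shF S) V W f)"
proof -
  note pre = asymptotic_settingD(5)[OF S]
  note rc = res_closed[OF S O V w]
  have "res (shE S) V W (res (shE S) \<Omega> V (w l)) = res (shE S) \<Omega> W (w l)" for l
    using pre O V W w[of l] unfolding alg_presheaf_def by simp
  then have "res (shE S) V W (of_real (b l) \<odot>\<^bsub>sec (shE S) V\<^esub> res (shE S) \<Omega> V (w l)) =
      of_real (b l) \<odot>\<^bsub>sec (shE S) W\<^esub> res (shE S) \<Omega> W (w l)" for l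
    using alg_presheafD(2)[OF pre V(1) W] rc[of l] by (simp add: top_alg_hom_def)
  with net_limit_restrict[OF S V(1) W _ lim] module_closed(4)[OF sections(1)[OF S V(1)] rc]
  show ?thesis by simp
qed

lemma converges_near_scale:
  fixes S :: "('x, 'l::order, 'k::real_normed_field, 'e, 'f, 'i) setting"
  assumes S: "asymptotic_setting S" and O: "openin (base S) \<Omega>"
    and w: "\<And>l. w l \<in> carrier (sec (shE S) \<Omega>)"
    and c: "(c \<longlongrightarrow> d) at_bot" and conv: "converges_near S \<Omega> x b w"
  shows "converges_near S \<Omega> x (\<lambda>l. c l * b l) w"
proof -
  obtain V f where V: "V \<in> open_nbhds S \<Omega> x"
    and f: "net_limit S V (\<lambda>l. of_real (b l) \<odot>\<^bsub>sec (shE S) V\<^esub> res (shE S) \<Omega> V (w l)) f"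
    using conv unfolding converges_near_def by (elim bexE exE)
  have oV: "openin (base S) V" "V \<subseteq> \<Omega>" using V by (simp_all add: open_nbhds_def)
  interpret module scalar_ring "sec (shE S) V"
    by (rule topological_algebraD(1)[OF sections(1)[OF S oV(1)]])
  note rc = res_closed[OF S O oV w]
  have "((\<lambda>l. of_real (c l) :: 'k) \<longlongrightarrow> of_real d) at_bot"
    using c by (rule tendsto_of_real)
  from net_limit_scale[OF S oV(1) _ this f] module_closed(4)[OF sections(1)[OF S oV(1)] rc]
  have "net_limit S V (\<lambda>l. of_real (c l) \<odot>\<^bsub>sec (shE S) V\<^esub>
      (of_real (b l) \<odot>\<^bsub>sec (shE S) V\<^esub> res (shE S) \<Omega> V (w l))) (of_real d \<odot>\<^bsub>sec (shF S) V\<^esub> f)"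
    by simp
  moreover have "of_real (c l * b l) \<odot>\<^bsub>sec (shE S) V\<^esub> res (shE S) \<Omega> V (w l) =
      of_real (c l) \<odot>\<^bsub>sec (shE S) V\<^esub> (of_real (b l) \<odot>\<^bsub>sec (shE S) V\<^esub> res (shE S) \<Omega> V (w l))" for l
    using smult_assoc1[of "of_real (c l)" "of_real (b l)"] rc by simp
  ultimately have "net_limit S V (\<lambda>l. of_real (c l * b l) \<odot>\<^bsub>sec (shE S) V\<^esub> res (shE S) \<Omega> V (w l))
      (of_real d \<odot>\<^bsub>sec (shF S) V\<^esub> f)"
    by (simp only:)
  then show ?thesis by (rule converges_nearI[OF V])
qed

lemma converges_near_mult:
  fixes S :: "('x, 'l::order, 'k::real_normed_field, 'e, 'f, 'i) setting"
  assumes S: "asymptotic_setting S" and O: "openin (base S) \<Omega>"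
    and u: "\<And>l. u l \<in> carrier (sec (shE S) \<Omega>)" and v: "\<And>l. v l \<in> carrier (sec (shE S) \<Omega>)"
    and conv: "converges_near S \<Omega> x b u" "converges_near S \<Omega> x d v"
  shows "converges_near S \<Omega> x (\<lambda>l. b l * d l) (\<lambda>l. u l \<otimes>\<^bsub>sec (shE S) \<Omega>\<^esub> v l)"
proof -
  obtain U f where U: "U \<in> open_nbhds S \<Omega> x"
    and f: "net_limit S U (\<lambda>l. of_real (b l) \<odot>\<^bsub>sec (shE S) U\<^esub> res (shE S) \<Omega> U (u l)) f"
    using conv(1) unfolding converges_near_def by (elim bexE exE)
  obtain V g where V: "V \<in> open_nbhds S \<Omega> x"
    and g: "net_limit S V (\<lambda>l. of_real (d l) \<odot>\<^bsub>sec (shE S) V\<^esub> res (shE S) \<Omega> V (v l)) g"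
    using conv(2) unfolding converges_near_def by (elim bexE exE)
  define W where "W = U \<inter> V"
  have W: "W \<in> open_nbhds S \<Omega> x" using U V by (auto simp: open_nbhds_def W_def)
  have o: "openin (base S) U" "U \<subseteq> \<Omega>" "openin (base S) V" "V \<subseteq> \<Omega>"
    "openin (base S) W" "W \<subseteq> \<Omega>" "W \<subseteq> U" "W \<subseteq> V"
    using U V W by (auto simp: open_nbhds_def W_def)
  let ?N = "sec (shE S) W"
  let ?\<rho> = "res (shE S) \<Omega> W"
  note s = sections(1)[OF S o(5)]
  interpret module scalar_ring ?N by (rule topological_algebraD(1)[OF s])
  note rc = res_closed[OF S O o(5,6) u] res_closed[OF S O o(5,6) v]
  note mc = module_closed(4)[OF s]
  note lim = weighted_net_limit_restrict[OF S O o(1,2,5,7) u f]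
    weighted_net_limit_restrict[OF S O o(3,4,5,8) v g]
  have "net_limit S W (\<lambda>l. (of_real (b l) \<odot>\<^bsub>?N\<^esub> ?\<rho> (u l)) \<otimes>\<^bsub>?N\<^esub> (of_real (d l) \<odot>\<^bsub>?N\<^esub> ?\<rho> (v l)))
      (res (shF S) U W f \<otimes>\<^bsub>sec (shF S) W\<^esub> res (shF S) V W g)"
    by (rule net_limit_mult[OF S o(5) mc[OF rc(1)] mc[OF rc(2)] lim])
  moreover have "of_real (b l * d l) \<odot>\<^bsub>?N\<^esub> ?\<rho> (u l \<otimes>\<^bsub>sec (shE S) \<Omega>\<^esub> v l) =
      (of_real (b l) \<odot>\<^bsub>?N\<^esub> ?\<rho> (u l)) \<otimes>\<^bsub>?N\<^esub> (of_real (d l) \<odot>\<^bsub>?N\<^esub> ?\<rho> (v l))" for l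
  proof -
    have "?\<rho> (u l \<otimes>\<^bsub>sec (shE S) \<Omega>\<^esub> v l) = ?\<rho> (u l) \<otimes>\<^bsub>?N\<^esub> ?\<rho> (v l)"
      using alg_presheafD(2)[OF asymptotic_settingD(5)[OF S] O o(5,6)] u v
      by (simp add: top_alg_hom_def)
    moreover have "?\<rho> (u l) \<otimes>\<^bsub>?N\<^esub> ?\<rho> (v l) \<in> carrier ?N"
      using topological_algebraD(2)[OF s] rc by blast
    ultimately show ?thesis
      using smult_assoc1[of "of_real (b l)" "of_real (d l)"]
      by (simp add: topological_algebraD(5)[OF s rc(1) mc[OF rc(2)]] topological_algebraD(6)[OF s rc])
  qed
  ultimately have "net_limit S W (\<lambda>l. of_real (b l * d l) \<odot>\<^bsub>?N\<^esub> ?\<rho> (u l \<otimes>\<^bsub>sec (shE S) \<Omega>\<^esub> v l))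
      (res (shF S) U W f \<otimes>\<^bsub>sec (shF S) W\<^esub> res (shF S) V W g)"
    by (simp only:)
  then show ?thesis by (rule converges_nearI[OF W])
qed


section \<open>Exponents of convergence\<close>

lemma conv_exps_iff:
  assumes "asymptotic_setting S" "openin (base S) \<Omega>" "u \<in> moderate_nets S \<Omega>"
  shows "r \<in> conv_exps S \<Omega> (gen_rel S \<Omega> `` {u}) x \<longleftrightarrow> 0 \<le> r \<and> converges_near S \<Omega> x (scl S r) u"
  unfolding conv_exps_class[OF assms] converges_near_def by (rule mem_Collect_eq)

lemma F_sing_supp_iff:
  fixes S :: "('x, 'l::order, 'k::real_normed_field, 'e, 'f, 'i) setting"
  assumes S: "asymptotic_setting S" and O: "openin (base S) \<Omega>" and u: "u \<in> gen_alg S \<Omega>"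
  shows "x \<in> F_sing_supp S \<Omega> u \<longleftrightarrow> x \<in> \<Omega> \<and> 0 \<notin> conv_exps S \<Omega> u x"
proof -
  obtain w where w: "w \<in> moderate_nets S \<Omega>" and u_eq: "u = gen_rel S \<Omega> `` {w}"
    using u unfolding gen_alg_def by (rule quotientE)
  have "(\<lambda>l. of_real (scl S 0 l) \<odot>\<^bsub>sec (shE S) V\<^esub> res (shE S) \<Omega> V (w l)) =
      (\<lambda>l. res (shE S) \<Omega> V (w l))" if V: "V \<in> open_nbhds S \<Omega> x" for V
  proof -
    have oV: "openin (base S) V" "V \<subseteq> \<Omega>" using V by (simp_all add: open_nbhds_def)
    interpret module scalar_ring "sec (shE S) V"
      by (rule topological_algebraD(1)[OF sections(1)[OF S oV(1)]])
    have "w l \<in> carrier (sec (shE S) \<Omega>)" for l using w by (simp add: moderate_nets_def)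
    from res_closed[OF S O oV this] show ?thesis
      using smult_one by (simp add: asymptotic_settingD(12)[OF S])
  qed
  then have "(\<exists>f. net_limit S V (\<lambda>l. of_real (scl S 0 l) \<odot>\<^bsub>sec (shE S) V\<^esub> res (shE S) \<Omega> V (w l)) f) \<longleftrightarrow>
      (\<exists>f. net_limit S V (\<lambda>l. res (shE S) \<Omega> V (w l)) f)" if "V \<in> open_nbhds S \<Omega> x" for V
    using that by (simp only:)
  then have "0 \<in> conv_exps S \<Omega> u x \<longleftrightarrow>
      (\<exists>V\<in>open_nbhds S \<Omega> x. \<exists>f. net_limit S V (\<lambda>l. res (shE S) \<Omega> V (w l)) f)"
    unfolding u_eq conv_exps_class[OF S O w] mem_Collect_eq by (simp cong: bex_cong)
  then show ?thesis unfolding u_eq F_sing_supp_class[OF S O w] by simp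
qed

text \<open>
  The quotient \<open>c\<close> of \<open>a(t)\<close> by \<open>a(r) a(s)\<close> is bounded by \<open>a(t - r - s)\<close>, which tends to \<open>0\<close> because
  \<open>t > r + s\<close>. For \<open>t = r + s\<close> the quotient would merely be bounded by \<open>1\<close> and need not converge.
\<close>

lemma scl_factor:
  assumes S: "asymptotic_setting S" and rs: "0 \<le> r" "0 \<le> s" "r + s < t"
  obtains c where "(c \<longlongrightarrow> 0) at_bot" "scl S t = (\<lambda>l. c l * (scl S r l * scl S s l))"
proof -
  note nn = asymptotic_settingD(11)[OF S]
  have sub: "scl S (p + q) l \<le> scl S p l * scl S q l" if "0 \<le> p" "0 \<le> q" for p q l
    using S that unfolding asymptotic_setting_def by blast
  define e where "e = t - (r + s)"
  have e: "0 < e" and t: "t = e + (r + s)" using rs by (auto simp: e_def)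
  have bound: "scl S t l \<le> scl S e l * (scl S r l * scl S s l)" for l
  proof -
    have "scl S t l \<le> scl S e l * scl S (r + s) l" unfolding t using e rs by (intro sub) auto
    also have "\<dots> \<le> scl S e l * (scl S r l * scl S s l)"
      using e rs by (intro mult_left_mono sub nn) auto
    finally show ?thesis .
  qed
  \<comment> \<open>Where \<open>a(r) a(s)\<close> vanishes, so does \<open>a(t)\<close>, and \<open>c = 0\<close> by the convention for division by zero.\<close>
  define c where "c = (\<lambda>l. scl S t l / (scl S r l * scl S s l))"
  have t0: "0 \<le> scl S t l" "0 \<le> scl S r l * scl S s l" "0 \<le> scl S e l" for l
    using nn e rs t by auto
  have "scl S t = (\<lambda>l. c l * (scl S r l * scl S s l))"
  proof
    show "scl S t l = c l * (scl S r l * scl S s l)" for l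
      using bound[of l] t0(1)[of l] by (cases "scl S r l * scl S s l = 0") (auto simp: c_def)
  qed
  moreover have "(c \<longlongrightarrow> 0) at_bot"
  proof (rule tendsto_sandwich)
    show "\<forall>\<^sub>F l in at_bot. 0 \<le> c l" using t0 by (simp add: c_def)
    show "\<forall>\<^sub>F l in at_bot. c l \<le> scl S e l"
    proof (rule always_eventually, rule allI)
      show "c l \<le> scl S e l" for l
        using t0(3)[of l] divide_right_mono[OF bound[of l] t0(2)[of l]]
        by (cases "scl S r l * scl S s l = 0") (auto simp: c_def)
    qed
    show "(scl S e \<longlongrightarrow> 0) at_bot" using S e unfolding asymptotic_setting_def by blast
  qed simp
  ultimately show ?thesis by (rule that[rotated])
qed

text \<open>
  For \<open>t > r\<close>, the case \<open>s = 0\<close> of \<open>scl_factor\<close> writes \<open>a(t)\<close> as \<open>a(r)\<close> times a null scalar net.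
\<close>

lemma conv_exps_upward:
  assumes S: "asymptotic_setting S" and O: "openin (base S) \<Omega>" and u: "u \<in> gen_alg S \<Omega>"
    and r: "r \<in> conv_exps S \<Omega> u x" and rt: "r \<le> t"
  shows "t \<in> conv_exps S \<Omega> u x"
proof (cases "r = t")
  case False
  obtain w where w: "w \<in> moderate_nets S \<Omega>" and u_eq: "u = gen_rel S \<Omega> `` {w}"
    using u unfolding gen_alg_def by (rule quotientE)
  have conv: "0 \<le> r" "converges_near S \<Omega> x (scl S r) w"
    using r by (simp_all add: u_eq conv_exps_iff[OF S O w])
  have "r + 0 < t" using rt False by simp
  then obtain c where c: "(c \<longlongrightarrow> 0) at_bot" "scl S t = (\<lambda>l. c l * (scl S r l * scl S 0 l))"
    by (rule scl_factor[OF S conv(1) order_refl])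
  have "scl S t = (\<lambda>l. c l * scl S r l)"
    using c(2) by (simp add: asymptotic_settingD(12)[OF S])
  moreover have "converges_near S \<Omega> x (\<lambda>l. c l * scl S r l) w"
    using w by (intro converges_near_scale[OF S O _ c(1) conv(2)]) (simp add: moderate_nets_def)
  ultimately show ?thesis using conv(1) rt by (simp add: u_eq conv_exps_iff[OF S O w])
qed (use r in simp)

text \<open>
  The scalar net \<open>c\<close> is a parameter because two choices occur: \<open>c = 1\<close> with \<open>r = 0\<close> or \<open>s = 0\<close>, when one
  factor converges by itself, and the quotient \<open>c\<close> from \<open>scl_factor\<close>, when both factors need weights.
\<close>

lemma conv_exps_mult:
  assumes S: "asymptotic_setting S" and O: "openin (base S) \<Omega>"
    and u: "u \<in> gen_alg S \<Omega>" and v: "v \<in> gen_alg S \<Omega>"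
    and r: "r \<in> conv_exps S \<Omega> u x" and s: "s \<in> conv_exps S \<Omega> v x" and t: "0 \<le> t"
    and c: "(c \<longlongrightarrow> d) at_bot" "scl S t = (\<lambda>l. c l * (scl S r l * scl S s l))"
  shows "t \<in> conv_exps S \<Omega> (gen_mult S \<Omega> u v) x"
proof -
  obtain w where w: "w \<in> moderate_nets S \<Omega>" and u_eq: "u = gen_rel S \<Omega> `` {w}"
    using u unfolding gen_alg_def by (rule quotientE)
  obtain z where z: "z \<in> moderate_nets S \<Omega>" and v_eq: "v = gen_rel S \<Omega> `` {z}"
    using v unfolding gen_alg_def by (rule quotientE)
  have wz: "w l \<in> carrier (sec (shE S) \<Omega>)" "z l \<in> carrier (sec (shE S) \<Omega>)" for l
    using w z by (simp_all add: moderate_nets_def)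
  note m = moderate_mult(1)[OF S O w z]
  have "converges_near S \<Omega> x (scl S r) w" "converges_near S \<Omega> x (scl S s) z"
    using r s by (simp_all add: u_eq v_eq conv_exps_iff[OF S O w] conv_exps_iff[OF S O z])
  from converges_near_mult[OF S O wz this]
  have "converges_near S \<Omega> x (\<lambda>l. c l * (scl S r l * scl S s l)) (\<lambda>l. w l \<otimes>\<^bsub>sec (shE S) \<Omega>\<^esub> z l)"
    using m by (intro converges_near_scale[OF S O _ c(1)]) (simp_all add: moderate_nets_def)
  then have "converges_near S \<Omega> x (scl S t) (\<lambda>l. w l \<otimes>\<^bsub>sec (shE S) \<Omega>\<^esub> z l)"
    by (simp only: c(2))
  then show ?thesis
    using t by (simp add: u_eq v_eq gen_mult_class[OF S O w z] conv_exps_iff[OF S O m])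
qed

text \<open>
  The supremum of an unbounded set of reals has no specified value, so boundedness must come first:
  a single exponent of convergence bounds \<open>\<Sigma>\<^sub>x(u)\<close>, because \<open>N\<^sub>x(u)\<close> is closed upwards.
\<close>

lemma above_Sup_sing_exps:
  assumes S: "asymptotic_setting S" and O: "openin (base S) \<Omega>" and u: "u \<in> gen_alg S \<Omega>"
    and proper: "sing_exps S \<Omega> u x \<noteq> {0..}" and r: "0 \<le> r" "Sup (sing_exps S \<Omega> u x) < r"
  shows "r \<in> conv_exps S \<Omega> u x"
proof -
  obtain q where q: "q \<in> conv_exps S \<Omega> u x" using proper unfolding sing_exps_def by blast
  have "bdd_above (sing_exps S \<Omega> u x)"
  proof (rule bdd_aboveI)
    fix p assume "p \<in> sing_exps S \<Omega> u x"
    then have "\<not> q \<le> p" using conv_exps_upward[OF S O u q] unfolding sing_exps_def by blast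
    then show "p \<le> q" by simp
  qed
  then have "r \<le> Sup (sing_exps S \<Omega> u x)" if "r \<in> sing_exps S \<Omega> u x"
    by (rule cSup_upper[OF that])
  then have "r \<notin> sing_exps S \<Omega> u x" using r(2) by auto
  with r(1) show ?thesis by (simp add: sing_exps_def)
qed


section \<open>The spectrum of a product\<close>

theorem theorem15:
  fixes S :: "('x, 'l::order, 'k::real_normed_field, 'e, 'f, 'i) setting"
    and \<Omega> D1 D2 D3 :: "'x set"
    and u v :: "('l \<Rightarrow> 'e) set"
    and E :: "'x \<Rightarrow> real set"
  assumes "asymptotic_setting S"
    and "openin (base S) \<Omega>"
    and "u \<in> gen_alg S \<Omega>"
    and "v \<in> gen_alg S \<Omega>"
    and "D1 = F_sing_supp S \<Omega> u - (F_sing_supp S \<Omega> u \<inter> F_sing_supp S \<Omega> v)"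
    and "D2 = F_sing_supp S \<Omega> v - (F_sing_supp S \<Omega> u \<inter> F_sing_supp S \<Omega> v)"
    and "D3 = F_sing_supp S \<Omega> u \<inter> F_sing_supp S \<Omega> v"
    and "\<And>x. x \<in> D3 \<Longrightarrow> E x =
           (if sing_exps S \<Omega> u x \<noteq> {0..} \<and> sing_exps S \<Omega> v x \<noteq> {0..}
            then {0..Sup (sing_exps S \<Omega> u x) + Sup (sing_exps S \<Omega> v x)}
            else {0..})"
  shows "sing_spectrum S \<Omega> (gen_mult S \<Omega> u v) \<subseteq>
           {(x, r). x \<in> D1 \<and> r \<in> sing_exps S \<Omega> u x} \<union>
           {(x, r). x \<in> D2 \<and> r \<in> sing_exps S \<Omega> v x} \<union>
           {(x, r). x \<in> D3 \<and> r \<in> E x}"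
proof -
  note S = assms(1) and O = assms(2) and u = assms(3) and v = assms(4)
  let ?N = "conv_exps S \<Omega>" and ?\<Sigma> = "sing_exps S \<Omega>"
  note supp = F_sing_supp_iff[OF S O u] F_sing_supp_iff[OF S O v]
  note one = asymptotic_settingD(12)[OF S]
  have nonneg: "0 \<le> r" if "r \<in> ?N w x" for r w x using that by (simp add: conv_exps_def)
  have left: "r \<in> ?N (gen_mult S \<Omega> u v) x" if "r \<in> ?N u x" "0 \<in> ?N v x" for r x
    by (rule conv_exps_mult[OF S O u v that nonneg[OF that(1)] tendsto_const[of 1]]) (simp add: one)
  have right: "r \<in> ?N (gen_mult S \<Omega> u v) x" if "0 \<in> ?N u x" "r \<in> ?N v x" for r x
    by (rule conv_exps_mult[OF S O u v that nonneg[OF that(2)] tendsto_const[of 1]]) (simp add: one)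
  have above: "t \<in> ?N (gen_mult S \<Omega> u v) x"
    if x: "x \<in> D3" and proper: "?\<Sigma> u x \<noteq> {0..}" "?\<Sigma> v x \<noteq> {0..}"
      and t: "Sup (?\<Sigma> u x) + Sup (?\<Sigma> v x) < t" "0 \<le> t" for t x
  proof -
    have sup_nonneg: "0 \<le> Sup (?\<Sigma> w x)" if w: "w \<in> gen_alg S \<Omega>" "?\<Sigma> w x \<noteq> {0..}" "0 \<in> ?\<Sigma> w x" for w
      \<comment> \<open>A negative supremum would put \<open>0\<close> among the exponents of convergence.\<close>
      using above_Sup_sing_exps[OF S O w(1,2), of 0] w(3) by (force simp: sing_exps_def)
    have "0 \<in> ?\<Sigma> u x" "0 \<in> ?\<Sigma> v x" using x assms(7) supp by (auto simp: sing_exps_def)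
    then have sup0: "0 \<le> Sup (?\<Sigma> u x)" "0 \<le> Sup (?\<Sigma> v x)" using sup_nonneg u v proper by simp_all
    \<comment> \<open>A third of the excess of \<open>t\<close> is added to each supremum; the last third makes \<open>t > r + s\<close> strict.\<close>
    define e where "e = (t - (Sup (?\<Sigma> u x) + Sup (?\<Sigma> v x))) / 3"
    define r where "r = Sup (?\<Sigma> u x) + e"
    define s where "s = Sup (?\<Sigma> v x) + e"
    have e: "0 < e" "r + s < t" using t by (simp_all add: e_def r_def s_def field_simps)
    have rs: "0 \<le> r" "0 \<le> s" "Sup (?\<Sigma> u x) < r" "Sup (?\<Sigma> v x) < s"
      using sup0 e by (simp_all add: r_def s_def)
    obtain c where c: "(c \<longlongrightarrow> 0) at_bot" "scl S t = (\<lambda>l. c l * (scl S r l * scl S s l))"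
      by (rule scl_factor[OF S rs(1,2) e(2)])
    show ?thesis
      by (rule conv_exps_mult[OF S O u v above_Sup_sing_exps[OF S O u proper(1) rs(1,3)]
            above_Sup_sing_exps[OF S O v proper(2) rs(2,4)] t(2) c])
  qed
  show ?thesis
  proof (intro subsetI)
    fix y assume "y \<in> sing_spectrum S \<Omega> (gen_mult S \<Omega> u v)"
    then obtain x r where y: "y = (x, r)" and x: "x \<in> \<Omega>" and r: "0 \<le> r"
      and sing: "r \<notin> ?N (gen_mult S \<Omega> u v) x"
      by (auto simp: sing_spectrum_def sing_exps_def)
    consider (none) "0 \<in> ?N u x" "0 \<in> ?N v x" | (only_u) "0 \<notin> ?N u x" "0 \<in> ?N v x"
      | (only_v) "0 \<in> ?N u x" "0 \<notin> ?N v x" | (both) "0 \<notin> ?N u x" "0 \<notin> ?N v x" by blast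
    then show "y \<in> {(x, r). x \<in> D1 \<and> r \<in> ?\<Sigma> u x} \<union> {(x, r). x \<in> D2 \<and> r \<in> ?\<Sigma> v x} \<union>
        {(x, r). x \<in> D3 \<and> r \<in> E x}"
    proof cases
      case none
      with left[OF conv_exps_upward[OF S O u none(1) r]] sing show ?thesis by blast
    next
      case only_u
      then have "r \<notin> ?N u x" using sing left by blast
      with only_u x r y show ?thesis by (simp add: assms(5) supp sing_exps_def)
    next
      case only_v
      then have "r \<notin> ?N v x" using sing right by blast
      with only_v x r y show ?thesis by (simp add: assms(6) supp sing_exps_def)
    next
      case both
      then have D3: "x \<in> D3" using x by (simp add: assms(7) supp)
      have "r \<in> E x" using above[OF D3 _ _ _ r] sing r by (auto simp: assms(8)[OF D3] not_less[symmetric])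
      with D3 y show ?thesis by simp
    qed
  qed
qed

end
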